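(* Let $p,q$ be positive integers and $\varphi:[0,+\infty)\to(0,+\infty)$ a non-decreasing unbounded function. Let $f_1$ be a meromorphic function and $g_1,g_2$ entire functions such that $\lambda_{g_1}(f_1)$ and $\lambda_{g_2}(f_1)$ exist. (Product) Suppose $g_1\cdot g_2$ satisfies the Property (A). Then $$\lambda_{g_1\cdot g_2}(f_1)\ge \min\{\lambda_{g_1}(f_1),\lambda_{g_2}(f_1)\}.$$ Equality holds when $\lambda_{g_i}(f_1)<\lambda_{g_j}(f_1)$, where $i,j\in\{1,2\}$, $i\ne j$, and $g_i$ satisfies the Property (A). (Quotient) Suppose instead that $\frac{g_1}{g_2}$ is entire and satisfies the Property (A). Then $$\lambda_{\frac{g_1}{g_2}}(f_1)\ge \min\{\lambda_{g_1}(f_1),\lambda_{g_2}(f_1)\}.$$ Equality holds when $\lambda_{g_1}(f_1)\ne\lambda_{g_2}(f_1)$ and $g_1$ satisfies the Property (A).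
   Context: Meromorphic and entire functions are on the whole plane $\mathbb{C}$. $M_g(r)=\max_{|z|=r}|g(z)|$, and $T_f(r)$ is the Nevanlinna characteristic function of $f$. For a non-constant entire $g$, $T_g$ is strictly increasing and continuous, with inverse $T_g^{-1}:(|g(0)|,\infty)\to(0,\infty)$, $\lim_{s\to\infty}T_g^{-1}(s)=\infty$. Iterated logarithms: $\log^{[0]}x=x$, $\log^{[k]}x=\log(\log^{[k-1]}x)$ for $k\ge1$. For fixed positive integers $p,q$ and fixed $\varphi$, the relative $(p,q)$-$\varphi$ lower order of a meromorphic $f$ with respect to an entire $g$ (full notation $\lambda_g^{(p,q)}(f,\varphi)$, abbreviated $\lambda_g(f)$) is $\liminf_{r\to\infty}\dfrac{\log^{[p]}T_g^{-1}(T_f(r))}{\log^{[q]}\varphi(r)}$. A non-constant entire $g$ has (satisfies) the Property (A) if for every $\sigma>1$ and all sufficiently large $r$, $[M_g(r)]^2\le M_g(r^\sigma)$. Standing assumption: all growth indicators that occur are nonzero and finite. *)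

theory Defs
  imports "HOL-Complex_Analysis.Complex_Analysis"
begin

definition max_modulus :: "(complex \<Rightarrow> complex) \<Rightarrow> real \<Rightarrow> real" where
  "max_modulus g r = (SUP z\<in>sphere 0 r. cmod (g z))"

definition nonconst_entire :: "(complex \<Rightarrow> complex) \<Rightarrow> bool" where
  "nonconst_entire g \<longleftrightarrow> g holomorphic_on UNIV \<and> \<not> g constant_on UNIV"

definition property_A :: "(complex \<Rightarrow> complex) \<Rightarrow> bool" where
  "property_A g \<longleftrightarrow> nonconst_entire g \<and>
     (\<forall>\<sigma>>1. \<forall>\<^sub>F r in at_top. (max_modulus g r)\<^sup>2 \<le> max_modulus g (r powr \<sigma>))"

(* Number of poles in the closed disc of radius t, with multiplicity. The functions is_pole and
   zorder depend only on punctured neighbourhoods, so the values that a function that is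
   meromorphic in the sense of meromorphic_on takes at its poles, or at removable
   singularities, play no role. *)
definition pole_count :: "(complex \<Rightarrow> complex) \<Rightarrow> real \<Rightarrow> nat" where
  "pole_count f t = (\<Sum>z | z \<in> cball 0 t \<and> is_pole f z. nat (- zorder f z))"

definition pole_counting_N :: "(complex \<Rightarrow> complex) \<Rightarrow> real \<Rightarrow> real" where
  "pole_counting_N f r =
     integral {0..r} (\<lambda>t. (real (pole_count f t) - real (pole_count f 0)) / t)
       + real (pole_count f 0) * ln r"

definition log_plus :: "real \<Rightarrow> real" where
  "log_plus x = ln (max 1 x)"

definition proximity_m :: "(complex \<Rightarrow> complex) \<Rightarrow> real \<Rightarrow> real" where
  "proximity_m f r =
     1 / (2 * pi) * integral {0..2 * pi} (\<lambda>\<theta>. log_plus (cmod (f (of_real r * cis \<theta>))))"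

definition nevanlinna_T :: "(complex \<Rightarrow> complex) \<Rightarrow> real \<Rightarrow> real" where
  "nevanlinna_T f r = proximity_m f r + pole_counting_N f r"

(* For a non-constant entire g, the characteristic may vanish on an initial interval (for
   example g z = z and r \<le> 1), but every s above its limit at 0 has exactly one preimage.
   Values at other s do not affect the limits below. *)
definition nevanlinna_T_inv :: "(complex \<Rightarrow> complex) \<Rightarrow> real \<Rightarrow> real" where
  "nevanlinna_T_inv g s = inv_into {0<..} (nevanlinna_T g) s"

definition iter_log :: "nat \<Rightarrow> real \<Rightarrow> real" where
  "iter_log k x = (ln ^^ k) x"

(* Relative (p,q)-phi lower order of f with respect to g; meaningful for non-constant entire g.
   Iterated logarithms of small arguments, where ln takes conventional values, do not affect
   the lower limit. *)
definition rel_lower_order ::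
  "nat \<Rightarrow> nat \<Rightarrow> (real \<Rightarrow> real) \<Rightarrow> (complex \<Rightarrow> complex) \<Rightarrow> (complex \<Rightarrow> complex) \<Rightarrow> ereal" where
  "rel_lower_order p q \<phi> g f =
     Liminf at_top (\<lambda>r. ereal (iter_log p (nevanlinna_T_inv g (nevanlinna_T f r))
                                / iter_log q (\<phi> r)))"

end

theory Submission
  imports Defs "HOL-Real_Asymp.Real_Asymp"
begin

text \<open>If \<open>a c = b\<close> with \<open>a, b, c\<close> entire, then \<open>T_a \<le> T_b + T_c + O(1)\<close>. Property (A) gives
  \<open>K T_g(r) \<le> T_g(r\<^sup>\<sigma>)\<close> for all \<open>K\<close>, all \<open>\<sigma> > 1\<close> and all large \<open>r\<close>. So if \<open>a\<close> has Property (A), or if both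
  \<open>b\<close> and \<open>c\<close> have it, the constants are absorbed: \<open>T_a(r) < max (T_b(r\<^sup>\<sigma>)) (T_c(r\<^sup>\<sigma>))\<close>. Passing to
  inverses, \<open>min (T_b\<inverse>(s)) (T_c\<inverse>(s)) \<le> (T_a\<inverse>(s))\<^sup>\<sigma>\<close>, and since iterated logarithms turn the power into
  a factor of at most \<open>\<sigma>\<close>, letting \<open>\<sigma>\<close> tend to 1 yields \<open>\<lambda>_a \<ge> min \<lambda>_b \<lambda>_c\<close>. The inequalities of the theorem are
  instances of this with the new function as \<open>a\<close>; the equalities are instances with \<open>g\<^sub>1\<close> or \<open>g\<^sub>2\<close> as
  \<open>a\<close>. For a quotient \<open>h\<close> with \<open>\<lambda>_g2 < \<lambda>_g1\<close> one takes \<open>a = g\<^sub>2\<close>, where Property (A) is known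
  for \<open>g\<^sub>1\<close> and \<open>h\<close> only.\<close>

subsection \<open>Circle averages\<close>

text \<open>Kept separate from \<open>proximity_m\<close>, so that linearity and monotonicity serve
  \<open>log_plus\<close>, truncated logarithms and real parts of entire functions alike.\<close>

definition circle_avg :: "(complex \<Rightarrow> real) \<Rightarrow> real \<Rightarrow> real" where
  "circle_avg u r = 1 / (2 * pi) * integral {0..2 * pi} (\<lambda>\<theta>. u (of_real r * cis \<theta>))"

lemma circle_integrable:
  assumes "continuous_on (sphere 0 r) u" "0 \<le> r"
  shows "(\<lambda>\<theta>. u (of_real r * cis \<theta>) :: real) integrable_on {0..2 * pi}"
proof -
  have "continuous_on {0..2*pi} (\<lambda>\<theta>. u (of_real r * cis \<theta>))"
    using assms(2)
    by (intro continuous_on_compose2[OF assms(1)] continuous_intros) (auto simp: norm_mult)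
  then show ?thesis
    by (rule integrable_continuous_interval)
qed

lemma circle_avg_mono:
  assumes "continuous_on (sphere 0 r) u" "continuous_on (sphere 0 r) v" "0 \<le> r"
    and "\<And>z. z \<in> sphere 0 r \<Longrightarrow> u z \<le> v z"
  shows "circle_avg u r \<le> circle_avg v r"
  unfolding circle_avg_def using assms
  by (intro mult_left_mono integral_le circle_integrable) (auto simp: norm_mult)

lemma circle_avg_add:
  assumes "continuous_on (sphere 0 r) u" "continuous_on (sphere 0 r) v" "0 \<le> r"
  shows "circle_avg (\<lambda>z. u z + v z) r = circle_avg u r + circle_avg v r"
  unfolding circle_avg_def using circle_integrable[OF assms(1,3)] circle_integrable[OF assms(2,3)]
  by (simp add: integral_add field_simps)

lemma circle_avg_diff:
  assumes "continuous_on (sphere 0 r) u" "continuous_on (sphere 0 r) v" "0 \<le> r"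
  shows "circle_avg (\<lambda>z. u z - v z) r = circle_avg u r - circle_avg v r"
  unfolding circle_avg_def using circle_integrable[OF assms(1,3)] circle_integrable[OF assms(2,3)]
  by (simp add: integral_diff field_simps)

lemma circle_avg_const: "circle_avg (\<lambda>_. c) r = c"
  by (simp add: circle_avg_def)

lemma circle_avg_add_const:
  assumes "continuous_on (sphere 0 r) u" "0 \<le> r"
  shows "circle_avg (\<lambda>z. u z + c) r = circle_avg u r + c"
  using circle_avg_add[OF assms(1) continuous_on_const[of _ c] assms(2)] by (simp add: circle_avg_const)

text \<open>Continuity is not assumed, because the bound is applied to the proximity function of a
  meromorphic function. A non-integrable integrand gives the default integral 0.\<close>

lemma circle_avg_nonneg:
  assumes "\<And>z. u z \<ge> 0"
  shows "circle_avg u r \<ge> 0"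
proof -
  have "integral {0..2*pi} (\<lambda>\<theta>. u (of_real r * cis \<theta>)) \<ge> 0"
    using assms by (cases "(\<lambda>\<theta>. u (of_real r * cis \<theta>)) integrable_on {0..2*pi}")
      (auto intro: integral_nonneg simp: not_integrable_integral)
  then show ?thesis
    by (simp add: circle_avg_def)
qed

text \<open>Cauchy's formula at the centre: along the circle, dz / z is i d\<theta>, so the contour
  integral becomes an angular mean.\<close>

lemma circle_avg_Re:
  assumes "P holomorphic_on UNIV" "r > 0"
  shows "circle_avg (\<lambda>z. Re (P z)) r = Re (P 0)"
proof -
  have "((\<lambda>u. P u / (u - 0)) has_contour_integral (2 * of_real pi * \<i> * P 0)) (circlepath 0 r)"
    using assms by (intro Cauchy_integral_circlepath_simple) (auto intro: holomorphic_on_subset)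
  then have "((\<lambda>t. P (of_real r * cis t) / (of_real r * cis t) * of_real r * \<i> * cis t)
      has_integral (2 * of_real pi * \<i> * P 0)) {0..2*pi}"
    unfolding circlepath_def by (subst (asm) has_contour_integral_part_circlepath_iff) auto
  then have "((\<lambda>t. \<i> * P (of_real r * cis t)) has_integral (2 * of_real pi * \<i> * P 0)) {0..2*pi}"
    using assms by (simp add: field_simps)
  from has_integral_mult_right[OF this, of "-\<i>"]
  have "((\<lambda>t. P (of_real r * cis t)) has_integral (2 * of_real pi * P 0)) {0..2*pi}"
    by (simp add: algebra_simps)
  from has_integral_Re[OF this]
  have "integral {0..2*pi} (\<lambda>t. Re (P (of_real r * cis t))) = 2 * pi * Re (P 0)"
    by (simp add: integral_unique)
  then show ?thesis
    by (simp add: circle_avg_def)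
qed

lemma continuous_circle_avg:
  assumes "continuous_on UNIV u"
  shows "continuous_on UNIV (circle_avg u)"
proof -
  have "continuous_on (UNIV \<times> cbox 0 (2*pi)) (\<lambda>(r, \<theta>). u (of_real r * cis \<theta>))"
    unfolding case_prod_beta
    by (intro continuous_on_compose2[OF assms] continuous_intros) auto
  from integral_continuous_on_param[OF this] show ?thesis
    unfolding circle_avg_def[abs_def] by (intro continuous_intros) auto
qed

subsection \<open>Approximation on a circle by real parts of polynomials\<close>

text \<open>Trigonometric polynomials on the circle, written without mixed monomials. In this form
  the real part agrees with that of a polynomial in \<open>z\<close> alone, so it is the trace of an
  entire function's real part.\<close>

definition circle_poly :: "real \<Rightarrow> (complex \<Rightarrow> complex) set" where
  "circle_poly r = {h. \<exists>p q. \<forall>z\<in>sphere 0 r. h z = poly p z + poly q (cnj z)}"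

lemma circle_poly_cong:
  "h \<in> circle_poly r \<Longrightarrow> (\<And>z. z \<in> sphere 0 r \<Longrightarrow> g z = h z) \<Longrightarrow> g \<in> circle_poly r"
  unfolding circle_poly_def by simp

lemma circle_poly_poly: "(\<lambda>z. poly p z) \<in> circle_poly r"
  unfolding circle_poly_def by (intro CollectI exI[of _ p] exI[of _ 0]) auto

lemma circle_poly_poly_cnj: "(\<lambda>z. poly q (cnj z)) \<in> circle_poly r"
  unfolding circle_poly_def by (intro CollectI exI[of _ 0] exI[of _ q]) auto

lemma circle_poly_const: "(\<lambda>_. c) \<in> circle_poly r"
  using circle_poly_poly[of "[:c:]"] by simp

lemma circle_poly_add:
  assumes "f \<in> circle_poly r" "g \<in> circle_poly r"
  shows "(\<lambda>z. f z + g z) \<in> circle_poly r"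
proof -
  obtain p q p' q' where "\<forall>z\<in>sphere 0 r. f z = poly p z + poly q (cnj z)"
    "\<forall>z\<in>sphere 0 r. g z = poly p' z + poly q' (cnj z)"
    using assms unfolding circle_poly_def by blast
  then show ?thesis
    unfolding circle_poly_def by (intro CollectI exI[of _ "p + p'"] exI[of _ "q + q'"]) auto
qed

lemma circle_poly_scale:
  assumes "f \<in> circle_poly r"
  shows "(\<lambda>z. c * f z) \<in> circle_poly r"
proof -
  obtain p q where "\<forall>z\<in>sphere 0 r. f z = poly p z + poly q (cnj z)"
    using assms unfolding circle_poly_def by blast
  then show ?thesis
    unfolding circle_poly_def
    by (intro CollectI exI[of _ "smult c p"] exI[of _ "smult c q"]) (auto simp: algebra_simps)
qed

text \<open>On the circle \<open>z * cnj z\<close> is the constant \<open>r\<^sup>2\<close>, so a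
  mixed monomial loses one factor of each kind. This relation is what makes the class closed under
  products.\<close>

lemma circle_poly_mult_id:
  assumes "f \<in> circle_poly r"
  shows "(\<lambda>z. z * f z) \<in> circle_poly r"
proof -
  obtain p q where pq: "\<forall>z\<in>sphere 0 r. f z = poly p z + poly q (cnj z)"
    using assms unfolding circle_poly_def by blast
  obtain c q' where q: "q = pCons c q'"
    by (cases q)
  have *: "z * (cnj z * w) = of_real (r\<^sup>2) * w" if "z \<in> sphere 0 r" for z w
    using that complex_norm_square[of z] by (simp flip: mult.assoc)
  have "z * f z = poly (pCons 0 (p + [:c:])) z + poly (smult (of_real (r\<^sup>2)) q') (cnj z)"
    if "z \<in> sphere 0 r" for z
    using pq that *[OF that, of "poly q' (cnj z)"] by (simp add: q distrib_left)
  then show ?thesis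
    unfolding circle_poly_def by blast
qed

lemma circle_poly_cnj:
  assumes "f \<in> circle_poly r"
  shows "(\<lambda>z. f (cnj z)) \<in> circle_poly r"
proof -
  obtain p q where pq: "\<forall>z\<in>sphere 0 r. f z = poly p z + poly q (cnj z)"
    using assms unfolding circle_poly_def by blast
  then show ?thesis
    unfolding circle_poly_def by (intro CollectI exI[of _ q] exI[of _ p]) (auto simp: add.commute)
qed

lemma circle_poly_mult_cnj:
  assumes "f \<in> circle_poly r"
  shows "(\<lambda>z. cnj z * f z) \<in> circle_poly r"
  using circle_poly_cnj[OF circle_poly_mult_id[OF circle_poly_cnj[OF assms]]] by simp

lemma circle_poly_mult:
  assumes "f \<in> circle_poly r" "g \<in> circle_poly r"
  shows "(\<lambda>z. f z * g z) \<in> circle_poly r"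
proof -
  obtain p q where pq: "\<forall>z\<in>sphere 0 r. f z = poly p z + poly q (cnj z)"
    using assms unfolding circle_poly_def by blast
  have "(\<lambda>z. poly p z * g z) \<in> circle_poly r" for p
  proof (induction p)
    case (pCons a p)
    from circle_poly_add[OF circle_poly_scale[OF assms(2), of a] circle_poly_mult_id[OF pCons.IH]]
    show ?case by (simp add: algebra_simps)
  qed (use circle_poly_const in simp)
  moreover have "(\<lambda>z. poly q (cnj z) * g z) \<in> circle_poly r" for q
  proof (induction q)
    case (pCons a p)
    from circle_poly_add[OF circle_poly_scale[OF assms(2), of a] circle_poly_mult_cnj[OF pCons.IH]]
    show ?case by (simp add: algebra_simps)
  qed (use circle_poly_const in simp)
  ultimately have "(\<lambda>z. poly p z * g z + poly q (cnj z) * g z) \<in> circle_poly r"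
    by (rule circle_poly_add)
  then show ?thesis
    by (rule circle_poly_cong) (use pq in \<open>auto simp: algebra_simps\<close>)
qed

lemma real_polynomial_function_circle_poly:
  assumes "real_polynomial_function g"
  shows "(\<lambda>z. complex_of_real (g z)) \<in> circle_poly r"
  using assms
proof (induction rule: real_polynomial_function.induct)
  case (linear f)
  interpret bounded_linear f by fact
  \<comment> \<open>The coefficients come from Re z = (z + cnj z) / 2 and Im z = (z - cnj z) / (2
    i).\<close>
  let ?a = "of_real (f 1) / 2 :: complex" and ?b = "of_real (f \<i>) / 2 :: complex"
  have eq: "complex_of_real (f z) = (?a - \<i> * ?b) * z + (?a + \<i> * ?b) * cnj z" for z
  proof -
    have "f z = f (Re z *\<^sub>R 1 + Im z *\<^sub>R \<i>)"
      by (rule arg_cong[of _ _ f]) (simp add: complex_eq_iff)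
    then have "f z = Re z * f 1 + Im z * f \<i>"
      by (simp only: add scale) simp
    then show ?thesis
      by (simp add: complex_eq_iff field_simps)
  qed
  have "(\<lambda>z. (?a - \<i> * ?b) * z + (?a + \<i> * ?b) * cnj z) \<in> circle_poly r"
    using circle_poly_add[OF circle_poly_poly[of "[:0, ?a - \<i> * ?b:]" r]
        circle_poly_poly_cnj[of "[:0, ?a + \<i> * ?b:]" r]]
    by (simp add: mult.commute)
  then show ?case
    by (rule circle_poly_cong) (rule eq)
next
  case (const c)
  show ?case by (rule circle_poly_const)
next
  case (add f g)
  from circle_poly_add[OF add.IH] show ?case by simp
next
  case (mult f g)
  from circle_poly_mult[OF mult.IH] show ?case by simp
qed

text \<open>Stone-Weierstrass gives a real polynomial function near \<open>u\<close>, and on the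
  circle it is a sum of polynomials in \<open>z\<close> and \<open>cnj z\<close>. Conjugating the
  second summand keeps its real part and makes it holomorphic.\<close>

lemma entire_Re_approx:
  fixes u :: "complex \<Rightarrow> real"
  assumes "continuous_on (sphere 0 r) u" "e > 0"
  obtains P where "P holomorphic_on UNIV"
    "\<And>z. z \<in> sphere 0 r \<Longrightarrow> u z < Re (P z)" "\<And>z. z \<in> sphere 0 r \<Longrightarrow> Re (P z) < u z + e"
proof -
  obtain g where g: "real_polynomial_function g" "\<And>z. z \<in> sphere 0 r \<Longrightarrow> \<bar>u z - g z\<bar> < e / 2"
    using Stone_Weierstrass_real_polynomial_function[OF _ assms(1), of "e/2"] assms(2) by auto
  obtain p q where pq: "\<And>z. z \<in> sphere 0 r \<Longrightarrow> complex_of_real (g z) = poly p z + poly q (cnj z)"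
    using real_polynomial_function_circle_poly[OF g(1), of r] unfolding circle_poly_def by blast
  \<comment> \<open>The shift by \<open>e / 2\<close> turns a two-sided error below
    \<open>e / 2\<close> into a one-sided error between 0 and \<open>e\<close>.\<close>
  define P where "P z = poly p z + poly (map_poly cnj q) z + of_real (e / 2)" for z
  have *: "Re (P z) = g z + e / 2" if "z \<in> sphere 0 r" for z
  proof -
    have "g z = Re (poly p z) + Re (poly q (cnj z))"
      using arg_cong[OF pq[OF that], of Re] by simp
    also have "Re (poly q (cnj z)) = Re (cnj (poly q (cnj z)))"
      by simp
    also have "cnj (poly q (cnj z)) = poly (map_poly cnj q) z"
      by (subst poly_cnj) simp
    finally show ?thesis by (simp add: P_def)
  qed
  then have "u z < Re (P z) \<and> Re (P z) < u z + e" if "z \<in> sphere 0 r" for z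
    using *[OF that] g(2)[OF that] by linarith
  moreover have "P holomorphic_on UNIV"
    unfolding P_def by (intro holomorphic_intros)
  ultimately show ?thesis
    using that by blast
qed

subsection \<open>The characteristic of an entire function\<close>

lemma continuous_on_log_max [continuous_intros]:
  fixes g :: "'a::topological_space \<Rightarrow> complex"
  assumes "continuous_on A g" "\<delta> > 0"
  shows "continuous_on A (\<lambda>z. ln (max \<delta> (cmod (g z))))"
  using assms by (intro continuous_intros) (auto simp: max_def)

lemma continuous_on_log_plus [continuous_intros]:
  "continuous_on A g \<Longrightarrow> continuous_on A (\<lambda>z. log_plus (cmod (g z)))"
  unfolding log_plus_def by (intro continuous_intros) auto

lemma log_plus_nonneg: "log_plus x \<ge> 0"
  by (simp add: log_plus_def)

lemma log_plus_mono: "x \<le> y \<Longrightarrow> log_plus x \<le> log_plus y"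
  by (auto simp: log_plus_def)

lemma log_plus_mult_le:
  assumes "x \<ge> 0" "y \<ge> 0"
  shows "log_plus (x * y) \<le> log_plus x + log_plus y"
proof -
  have "max 1 (x * y) \<le> max 1 x * max 1 y"
    using assms mult_mono[of 1 "max 1 x" 1 "max 1 y"] mult_mono[of x "max 1 x" y "max 1 y"] by auto
  then have "ln (max 1 (x * y)) \<le> ln (max 1 x * max 1 y)"
    by (subst ln_le_cancel_iff) auto
  also have "\<dots> = ln (max 1 x) + ln (max 1 y)"
    by (rule ln_mult_pos) auto
  finally show ?thesis
    by (simp add: log_plus_def)
qed

lemma nevanlinna_T_entire:
  assumes "g holomorphic_on UNIV"
  shows "nevanlinna_T g = circle_avg (\<lambda>z. log_plus (cmod (g z)))"
proof
  fix r
  have "\<not> is_pole g z" for z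
    using assms by (intro analytic_at_imp_no_pole) (auto intro: analytic_on_subset simp flip: analytic_on_open)
  then have "pole_count g t = 0" for t
    by (simp add: pole_count_def)
  then show "nevanlinna_T g r = circle_avg (\<lambda>z. log_plus (cmod (g z))) r"
    by (simp add: nevanlinna_T_def pole_counting_N_def proximity_m_def circle_avg_def)
qed

text \<open>The maximum principle is applied to \<open>g / exp P\<close>. Since \<open>exp P\<close> has no zeros, this replaces Jensen's
  formula and the Poisson integral, and zeros of \<open>g\<close> on the circle need no special treatment.\<close>

lemma entire_exp_majorant:
  assumes g: "g holomorphic_on UNIV" and "r > 0" "\<delta> > 0" "e > 0"
  obtains P where "P holomorphic_on UNIV"
    "\<And>z. z \<in> sphere 0 r \<Longrightarrow> Re (P z) \<le> ln (max \<delta> (cmod (g z))) + e"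
    "\<And>z. z \<in> cball 0 r \<Longrightarrow> max \<delta> (cmod (g z)) \<le> exp (Re (P z))"
proof -
  have "continuous_on (sphere 0 r) (\<lambda>z. ln (max \<delta> (cmod (g z))))"
    using assms by (intro continuous_intros holomorphic_on_imp_continuous_on holomorphic_on_subset[OF g]) auto
  then obtain P where P: "P holomorphic_on UNIV"
    "\<And>z. z \<in> sphere 0 r \<Longrightarrow> ln (max \<delta> (cmod (g z))) < Re (P z)"
    "\<And>z. z \<in> sphere 0 r \<Longrightarrow> Re (P z) < ln (max \<delta> (cmod (g z))) + e"
    using entire_Re_approx \<open>e > 0\<close> by blast
  have bd: "max \<delta> (cmod (g z)) \<le> exp (Re (P z))" if "z \<in> sphere 0 r" for z
  proof -
    have "exp (ln (max \<delta> (cmod (g z)))) \<le> exp (Re (P z))"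
      using P(2)[OF that] by simp
    then show ?thesis
      using \<open>\<delta> > 0\<close> by (subst (asm) exp_ln) (auto simp: max_def)
  qed
  have max_pr: "cmod (h z) \<le> exp (Re (P z))"
    if h: "h holomorphic_on UNIV" "\<And>z. z \<in> sphere 0 r \<Longrightarrow> cmod (h z) \<le> exp (Re (P z))"
      and z: "z \<in> cball 0 r" for h z
  proof -
    have hol: "(\<lambda>z. h z * exp (- P z)) holomorphic_on UNIV"
      by (intro holomorphic_intros h(1) P(1))
    have eq: "cmod (h z * exp (- P z)) = cmod (h z) / exp (Re (P z))" for z
      by (simp add: norm_mult norm_inverse exp_minus divide_inverse)
    have "cmod (h z * exp (- P z)) \<le> 1"
    proof (rule maximum_modulus_frontier[of "\<lambda>z. h z * exp (- P z)" "cball 0 r"])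
      show "continuous_on (closure (cball 0 r)) (\<lambda>z. h z * exp (- P z))"
        using hol by (meson holomorphic_on_imp_continuous_on continuous_on_subset subset_UNIV)
      show "cmod (h z * exp (- P z)) \<le> 1" if "z \<in> frontier (cball 0 r)" for z
        using h(2)[of z] that \<open>r > 0\<close>
        unfolding eq by simp
    qed (use z hol in \<open>auto intro: holomorphic_on_subset\<close>)
    then show ?thesis
      unfolding eq by simp
  qed
  \<comment> \<open>The maximum of \<open>\<delta>\<close> and |g| is not the modulus of a
    holomorphic function, so the principle is applied to \<open>g\<close> and to the constant
    \<open>\<delta>\<close> separately.\<close>
  have "max \<delta> (cmod (g z)) \<le> exp (Re (P z))" if "z \<in> cball 0 r" for z
    using max_pr[of "\<lambda>_. of_real \<delta>" z] max_pr[OF g, of z] that bd \<open>\<delta> > 0\<close> by auto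
  then show ?thesis
    using that[OF P(1)] P(3) by (meson less_imp_le)
qed

text \<open>By the mean value property, the majorant's real part at the centre is its circle
  average. For \<open>\<delta> = 1\<close> the average on the right is the characteristic of
  \<open>g\<close>.\<close>

lemma circle_avg_Re_majorant_le:
  assumes "g holomorphic_on UNIV" "P holomorphic_on UNIV" "r > 0" "\<delta> > 0"
    and "\<And>z. z \<in> sphere 0 r \<Longrightarrow> Re (P z) \<le> ln (max \<delta> (cmod (g z))) + e"
  shows "Re (P 0) \<le> circle_avg (\<lambda>z. ln (max \<delta> (cmod (g z)))) r + e"
proof -
  have c: "continuous_on (sphere 0 r) (\<lambda>z. ln (max \<delta> (cmod (g z))))"
    using assms
    by (intro continuous_intros holomorphic_on_imp_continuous_on holomorphic_on_subset[OF assms(1)]) auto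
  have "Re (P 0) = circle_avg (\<lambda>z. Re (P z)) r"
    using assms by (simp add: circle_avg_Re)
  also have "\<dots> \<le> circle_avg (\<lambda>z. ln (max \<delta> (cmod (g z))) + e) r"
  proof (rule circle_avg_mono[OF _ continuous_on_add[OF c continuous_on_const]])
    show "continuous_on (sphere 0 r) (\<lambda>z. Re (P z))"
      by (intro continuous_intros holomorphic_on_imp_continuous_on holomorphic_on_subset[OF assms(2)]) auto
  qed (use assms in auto)
  also have "\<dots> = circle_avg (\<lambda>z. ln (max \<delta> (cmod (g z)))) r + e"
    using c assms by (simp add: circle_avg_add_const)
  finally show ?thesis .
qed

text \<open>The majorant bounds |g| at the centre, where its real part is controlled by the circle
  average. The left side is free of \<open>\<delta>\<close> and \<open>r\<close>, so
  \<open>\<delta>\<close> may later vary with the radius.\<close>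

lemma jensen_inequality:
  assumes "g holomorphic_on UNIV" "g 0 \<noteq> 0" "r > 0" "\<delta> > 0"
  shows "ln (cmod (g 0)) \<le> circle_avg (\<lambda>z. ln (max \<delta> (cmod (g z)))) r"
proof (rule field_le_epsilon)
  fix e :: real assume "e > 0"
  obtain P where P: "P holomorphic_on UNIV"
    "\<And>z. z \<in> sphere 0 r \<Longrightarrow> Re (P z) \<le> ln (max \<delta> (cmod (g z))) + e"
    "\<And>z. z \<in> cball 0 r \<Longrightarrow> max \<delta> (cmod (g z)) \<le> exp (Re (P z))"
    using entire_exp_majorant[OF assms(1,3,4) \<open>e > 0\<close>] by blast
  have "cmod (g 0) \<le> exp (Re (P 0))"
    using P(3)[of 0] assms by auto
  then have "ln (cmod (g 0)) \<le> Re (P 0)"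
    using assms by (metis ln_exp ln_le_cancel_iff exp_gt_zero zero_less_norm_iff)
  with circle_avg_Re_majorant_le[OF assms(1) P(1) assms(3,4) P(2)]
  show "ln (cmod (g 0)) \<le> circle_avg (\<lambda>z. ln (max \<delta> (cmod (g z)))) r + e"
    by simp
qed

text \<open>The majorant built on the larger circle dominates on the smaller one too, and the mean
  of its real part is the same on both.\<close>

lemma nevanlinna_T_mono:
  assumes g: "g holomorphic_on UNIV" and "0 < \<rho>" "\<rho> \<le> r"
  shows "nevanlinna_T g \<rho> \<le> nevanlinna_T g r"
proof (rule field_le_epsilon)
  fix e :: real assume "e > 0"
  have "r > 0" using assms by simp
  obtain P where P: "P holomorphic_on UNIV"
    "\<And>z. z \<in> sphere 0 r \<Longrightarrow> Re (P z) \<le> ln (max 1 (cmod (g z))) + e"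
    "\<And>z. z \<in> cball 0 r \<Longrightarrow> max 1 (cmod (g z)) \<le> exp (Re (P z))"
    using entire_exp_majorant[OF g \<open>r > 0\<close> zero_less_one \<open>e > 0\<close>] by blast
  have le: "log_plus (cmod (g z)) \<le> Re (P z)" if "z \<in> sphere 0 \<rho>" for z
    unfolding log_plus_def using P(3)[of z] that assms
    by (metis ln_exp ln_le_cancel_iff exp_gt_zero less_le_trans max.cobounded1 mem_sphere_0 mem_cball_0 zero_less_one)
  have "nevanlinna_T g \<rho> \<le> circle_avg (\<lambda>z. Re (P z)) \<rho>"
    unfolding nevanlinna_T_entire[OF g] using le assms
    by (intro circle_avg_mono continuous_intros holomorphic_on_imp_continuous_on
        holomorphic_on_subset[OF g] holomorphic_on_subset[OF P(1)]) auto
  also have "\<dots> = Re (P 0)"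
    using assms P(1) by (simp add: circle_avg_Re)
  also have "\<dots> \<le> nevanlinna_T g r + e"
    unfolding nevanlinna_T_entire[OF g] log_plus_def
    by (rule circle_avg_Re_majorant_le[OF g P(1) \<open>r > 0\<close> _ P(2)]) auto
  finally show "nevanlinna_T g \<rho> \<le> nevanlinna_T g r + e" .
qed

lemma nevanlinna_T_nonneg: "g holomorphic_on UNIV \<Longrightarrow> nevanlinna_T g r \<ge> 0"
  by (simp add: nevanlinna_T_entire circle_avg_nonneg log_plus_nonneg)

lemma continuous_on_nevanlinna_T:
  assumes "g holomorphic_on UNIV"
  shows "continuous_on A (nevanlinna_T g)"
proof -
  have "continuous_on UNIV (nevanlinna_T g)"
    unfolding nevanlinna_T_entire[OF assms]
    by (intro continuous_circle_avg continuous_intros holomorphic_on_imp_continuous_on assms)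
  then show ?thesis
    by (rule continuous_on_subset) auto
qed

text \<open>Harnack's inequality on the disc of half the radius, with constant (1 + 1/2) / (1 - 1/2)
  = 3. The Schwarz lemma is applied to a Cayley transform, which takes the right half-plane to the
  unit disc.\<close>

lemma harnack_half:
  assumes P: "P holomorphic_on UNIV" and "r > 0"
    and pos: "\<And>z. z \<in> ball 0 (2 * r) \<Longrightarrow> Re (P z) \<ge> 0" and z: "z \<in> cball 0 r"
  shows "Re (P z) \<le> 3 * Re (P 0)"
proof (rule field_le_epsilon)
  fix e :: real assume "e > 0"
  define c where "c = Re (P 0) + e / 2"
  \<comment> \<open>Normalisation to the unit disc: removing the imaginary part at 0 makes
    \<open>Q 0\<close> the real number \<open>c\<close>, and adding \<open>e / 2\<close> makes the
    real part strictly positive.\<close>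
  define Q where "Q w = P (of_real (2 * r) * w) - \<i> * of_real (Im (P 0)) + of_real (e / 2)" for w
  have cpos: "c > 0" and Q0: "Q 0 = of_real c"
    using pos[of 0] \<open>r > 0\<close> \<open>e > 0\<close> by (auto simp: c_def Q_def complex_eq_iff)
  have Qpos: "Re (Q w) > 0" if "w \<in> ball 0 1" for w
    using pos[of "of_real (2 * r) * w"] that \<open>r > 0\<close> \<open>e > 0\<close> by (auto simp: Q_def norm_mult)
  have Qhol: "Q holomorphic_on ball 0 1"
    unfolding Q_def
    by (intro holomorphic_intros holomorphic_on_compose_gen[OF _ P, unfolded o_def]) auto
  have nz: "Q w + of_real c \<noteq> 0" if "w \<in> ball 0 1" for w
    using Qpos[OF that] cpos by (auto simp: complex_eq_iff)
  define w where "w = z / of_real (2 * r)"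
  have w: "cmod w \<le> 1 / 2"
    using z \<open>r > 0\<close> by (simp add: w_def norm_divide field_simps)
  have "cmod ((Q w - of_real c) / (Q w + of_real c)) \<le> cmod w"
  proof (rule Schwarz_Lemma(1))
    show "(\<lambda>w. (Q w - of_real c) / (Q w + of_real c)) holomorphic_on ball 0 1"
      using nz by (intro holomorphic_intros Qhol) auto
    show "cmod ((Q w - of_real c) / (Q w + of_real c)) < 1" if "cmod w < 1" for w
    proof -
      \<comment> \<open>The two squares differ by 4 c Re (Q w).\<close>
      have "(cmod (Q w - of_real c))\<^sup>2 < (cmod (Q w + of_real c))\<^sup>2"
        using mult_pos_pos[OF Qpos[of w] cpos] that
        unfolding cmod_power2 by (simp add: power2_eq_square algebra_simps)
      then have "cmod (Q w - of_real c) < cmod (Q w + of_real c)"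
        by (rule power2_less_imp_less) simp
      then show ?thesis
        using nz[of w] that by (simp add: norm_divide)
    qed
  qed (use w Q0 in auto)
  with w have "cmod ((Q w - of_real c) / (Q w + of_real c)) \<le> 1 / 2"
    by linarith
  then have "cmod (Q w - of_real c) \<le> cmod (Q w + of_real c) / 2"
    using nz[of w] w by (simp add: norm_divide field_simps)
  moreover have "cmod (Q w) - c \<le> cmod (Q w - of_real c)" "cmod (Q w + of_real c) \<le> cmod (Q w) + c"
    using norm_triangle_ineq2[of "Q w" "of_real c"] norm_triangle_ineq[of "Q w" "of_real c"] cpos by auto
  ultimately have "cmod (Q w) \<le> 3 * c"
    by (simp add: field_simps)
  then have "Re (Q w) \<le> 3 * c"
    using complex_Re_le_cmod order_trans by blast
  moreover have "Re (Q w) = Re (P z) + e / 2"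
    using \<open>r > 0\<close> by (simp add: Q_def w_def)
  ultimately show "Re (P z) \<le> 3 * Re (P 0) + e"
    by (simp add: c_def)
qed

text \<open>The majorant on the circle of radius 2 r dominates \<open>log_plus\<close>, so its real
  part is nonnegative and Harnack applies. Its value at the centre exceeds the characteristic by at
  most the chosen error.\<close>

lemma log_plus_le_nevanlinna_T:
  assumes g: "g holomorphic_on UNIV" and "r > 0" and z: "z \<in> cball 0 r"
  shows "log_plus (cmod (g z)) \<le> 3 * nevanlinna_T g (2 * r)"
proof (rule field_le_epsilon)
  fix e :: real assume "e > 0"
  then have "e / 3 > 0" by simp
  have r2: "2 * r > 0" using \<open>r > 0\<close> by simp
  obtain P where P: "P holomorphic_on UNIV"
    "\<And>z. z \<in> sphere 0 (2 * r) \<Longrightarrow> Re (P z) \<le> ln (max 1 (cmod (g z))) + e / 3"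
    "\<And>z. z \<in> cball 0 (2 * r) \<Longrightarrow> max 1 (cmod (g z)) \<le> exp (Re (P z))"
    using entire_exp_majorant[OF g r2 zero_less_one \<open>e / 3 > 0\<close>] by blast
  have le: "log_plus (cmod (g z)) \<le> Re (P z)" if "z \<in> cball 0 (2 * r)" for z
    unfolding log_plus_def using P(3)[OF that]
    by (metis ln_exp ln_le_cancel_iff exp_gt_zero less_le_trans max.cobounded1 zero_less_one)
  have "log_plus (cmod (g z)) \<le> Re (P z)"
    using le[of z] z \<open>r > 0\<close> by simp
  also have "\<dots> \<le> 3 * Re (P 0)"
  proof (rule harnack_half[OF P(1) \<open>r > 0\<close> _ z])
    show "Re (P w) \<ge> 0" if "w \<in> ball 0 (2 * r)" for w
      using le[of w] log_plus_nonneg[of "cmod (g w)"] that by simp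
  qed
  also have "Re (P 0) \<le> nevanlinna_T g (2 * r) + e / 3"
    unfolding nevanlinna_T_entire[OF g] log_plus_def
    by (rule circle_avg_Re_majorant_le[OF g P(1) r2 _ P(2)]) auto
  finally show "log_plus (cmod (g z)) \<le> 3 * nevanlinna_T g (2 * r) + e"
    by simp
qed

text \<open>A bounded characteristic would bound \<open>g\<close> itself by the preceding estimate,
  against Liouville. Monotonicity then turns one large value into a limit.\<close>

lemma filterlim_nevanlinna_T:
  assumes "nonconst_entire g"
  shows "filterlim (nevanlinna_T g) at_top at_top"
  unfolding filterlim_at_top
proof
  fix K :: real
  have g: "g holomorphic_on UNIV"
    using assms by (simp add: nonconst_entire_def)
  have "\<exists>r>0. nevanlinna_T g r > K"
  proof (rule ccontr)
    assume "\<not> ?thesis"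
    then have le: "nevanlinna_T g r \<le> K" if "r > 0" for r
      using that by (metis not_le)
    have "cmod (g z) \<le> exp (3 * K)" for z
    proof -
      have "log_plus (cmod (g z)) \<le> 3 * nevanlinna_T g (2 * (cmod z + 1))"
        by (rule log_plus_le_nevanlinna_T[OF g]) (auto intro: add_nonneg_pos)
      also have "\<dots> \<le> 3 * K"
        using le[of "2 * (cmod z + 1)"] by (simp add: add_nonneg_pos)
      finally have le: "ln (max 1 (cmod (g z))) \<le> 3 * K"
        by (simp add: log_plus_def)
      have "cmod (g z) \<le> exp (ln (max 1 (cmod (g z))))"
        by (subst exp_ln) auto
      also have "\<dots> \<le> exp (3 * K)"
        using le by (subst exp_le_cancel_iff)
      finally show ?thesis .
    qed
    then have "bounded (range g)"
      by (auto simp: bounded_iff)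
    with g have "g constant_on UNIV"
      using Liouville_theorem by (auto simp: constant_on_def)
    with assms show False
      by (simp add: nonconst_entire_def)
  qed
  then obtain r where r: "r > 0" "nevanlinna_T g r > K" by blast
  show "\<forall>\<^sub>F x in at_top. K \<le> nevanlinna_T g x"
    using eventually_ge_at_top[of r]
  proof eventually_elim
    case (elim x)
    with nevanlinna_T_mono[OF g r(1), of x] r(2) show ?case by linarith
  qed
qed

subsection \<open>Characteristics of products and quotients\<close>

lemma nevanlinna_T_mult_le:
  assumes "f holomorphic_on UNIV" "g holomorphic_on UNIV" "r \<ge> 0"
  shows "nevanlinna_T (\<lambda>z. f z * g z) r \<le> nevanlinna_T f r + nevanlinna_T g r"
proof -
  have c: "continuous_on (sphere 0 r) f" "continuous_on (sphere 0 r) g"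
    using assms by (meson continuous_on_subset holomorphic_on_imp_continuous_on subset_UNIV)+
  have "circle_avg (\<lambda>z. log_plus (cmod (f z * g z))) r
      \<le> circle_avg (\<lambda>z. log_plus (cmod (f z)) + log_plus (cmod (g z))) r"
    using assms c by (intro circle_avg_mono continuous_intros) (auto simp: norm_mult log_plus_mult_le)
  also have "\<dots> = circle_avg (\<lambda>z. log_plus (cmod (f z))) r + circle_avg (\<lambda>z. log_plus (cmod (g z))) r"
    using assms c by (intro circle_avg_add continuous_intros) auto
  finally show ?thesis
    using assms by (simp add: nevanlinna_T_entire holomorphic_on_mult)
qed

text \<open>\<open>jensen_inequality\<close> requires a non-zero value at the origin, so a zero
  there is split off first.\<close>

lemma entire_factor_zero_at_0:
  assumes c: "c holomorphic_on UNIV" and "c w \<noteq> 0"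
  obtains k d where "d holomorphic_on UNIV" "d 0 \<noteq> 0" "\<And>z. c z = z ^ k * d z"
proof -
  define k where "k = nat (zorder c 0)"
  obtain r where r: "r > 0" "zor_poly c 0 holomorphic_on cball 0 r"
    "\<And>w. w \<in> cball 0 r \<Longrightarrow> c w = zor_poly c 0 w * w ^ k \<and> zor_poly c 0 w \<noteq> 0"
    using zorder_exist_zero[OF c open_UNIV connected_UNIV UNIV_I, of 0] \<open>c w \<noteq> 0\<close>
    unfolding k_def by (metis UNIV_I diff_zero)
  \<comment> \<open>Near 0 this agrees with \<open>zor_poly c 0\<close>, away from 0 with the
    quotient; holomorphy is glued from the two open pieces.\<close>
  define d where "d z = (if z = 0 then zor_poly c 0 0 else c z / z ^ k)" for z
  have "d holomorphic_on ball 0 r"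
  proof (rule holomorphic_transform)
    show "zor_poly c 0 holomorphic_on ball 0 r"
      using r(2) by (rule holomorphic_on_subset) auto
    show "zor_poly c 0 z = d z" if "z \<in> ball 0 r" for z
      using r(3)[of z] that by (auto simp: d_def field_simps)
  qed
  moreover have "d holomorphic_on - {0}"
  proof (rule holomorphic_transform)
    show "(\<lambda>z. c z / z ^ k) holomorphic_on - {0}"
      by (intro holomorphic_intros holomorphic_on_subset[OF c]) auto
  qed (auto simp: d_def)
  ultimately have "d holomorphic_on (ball 0 r \<union> - {0})"
    by (rule holomorphic_on_Un) auto
  moreover have "ball 0 r \<union> - {0} = (UNIV :: complex set)"
    using \<open>r > 0\<close> by auto
  ultimately have "d holomorphic_on UNIV" by simp
  moreover have "d 0 \<noteq> 0"
    using r(1) r(3)[of 0] by (simp add: d_def)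
  moreover have "c z = z ^ k * d z" for z
    using r(1) r(3)[of 0] by (auto simp: d_def)
  ultimately show ?thesis
    using that by blast
qed

text \<open>After the zero at the origin is split off, the factor \<open>z ^ k\<close> has modulus
  at least 1 on circles with \<open>r \<ge> 1\<close>, so Jensen's bound for the other factor
  carries over. One constant works for all \<open>r\<close> and \<open>\<delta>\<close>.\<close>

lemma circle_avg_log_max_lower_bound:
  assumes c: "c holomorphic_on UNIV" and "c w \<noteq> 0"
  obtains C where "\<And>r \<delta>. r \<ge> 1 \<Longrightarrow> \<delta> > 0 \<Longrightarrow> C \<le> circle_avg (\<lambda>z. ln (max \<delta> (cmod (c z)))) r"
proof -
  obtain k d where d: "d holomorphic_on UNIV" "d 0 \<noteq> 0" "\<And>z. c z = z ^ k * d z"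
    using entire_factor_zero_at_0[OF assms] by metis
  have "ln (cmod (d 0)) \<le> circle_avg (\<lambda>z. ln (max \<delta> (cmod (c z)))) r"
    if "r \<ge> 1" "\<delta> > 0" for r \<delta>
  proof -
    have "ln (cmod (d 0)) \<le> circle_avg (\<lambda>z. ln (max \<delta> (cmod (d z)))) r"
      using d that by (intro jensen_inequality) auto
    also have "\<dots> \<le> circle_avg (\<lambda>z. ln (max \<delta> (cmod (c z)))) r"
    proof (rule circle_avg_mono)
      fix z :: complex assume "z \<in> sphere 0 r"
      then have "1 * cmod (d z) \<le> cmod (c z)"
        unfolding d(3) norm_mult norm_power using that
        by (intro mult_right_mono one_le_power) auto
      then have "max \<delta> (cmod (d z)) \<le> max \<delta> (cmod (c z))"
        by auto
      then show "ln (max \<delta> (cmod (d z))) \<le> ln (max \<delta> (cmod (c z)))"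
        using that by (subst ln_le_cancel_iff) (auto simp: less_max_iff_disj)
    qed (use that in \<open>auto intro!: continuous_intros holomorphic_on_imp_continuous_on
        holomorphic_on_subset[OF c] holomorphic_on_subset[OF d(1)]\<close>)
    finally show ?thesis .
  qed
  then show ?thesis
    using that by blast
qed

text \<open>Nevanlinna's first main theorem in disguise. On the circle of radius \<open>r\<close>, cutting \<open>|c|\<close> off below
  at \<open>\<delta> = 1 / max |a|\<close> makes the pointwise inequality survive at the zeros of \<open>c\<close>.\<close>

lemma nevanlinna_T_quotient_le:
  assumes a: "a holomorphic_on UNIV" and b: "b holomorphic_on UNIV" and c: "c holomorphic_on UNIV"
    and "c w \<noteq> 0" and eq: "\<And>z. c z \<noteq> 0 \<Longrightarrow> a z * c z = b z"
  obtains C where "\<And>r. r \<ge> 1 \<Longrightarrow> nevanlinna_T a r \<le> nevanlinna_T b r + nevanlinna_T c r + C"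
proof -
  obtain C where C: "\<And>r \<delta>. r \<ge> 1 \<Longrightarrow> \<delta> > 0 \<Longrightarrow> C \<le> circle_avg (\<lambda>z. ln (max \<delta> (cmod (c z)))) r"
    using circle_avg_log_max_lower_bound[OF c \<open>c w \<noteq> 0\<close>] by blast
  have "nevanlinna_T a r \<le> nevanlinna_T b r + nevanlinna_T c r + - C" if "r \<ge> 1" for r
  proof -
    have cont: "continuous_on (sphere 0 r) a" "continuous_on (sphere 0 r) b" "continuous_on (sphere 0 r) c"
      using a b c by (meson continuous_on_subset holomorphic_on_imp_continuous_on subset_UNIV)+
    obtain M where M: "M > 0" "\<And>z. z \<in> sphere 0 r \<Longrightarrow> cmod (a z) \<le> M"
    proof -
      have "bounded (a ` sphere 0 r)"
        by (intro compact_imp_bounded compact_continuous_image cont compact_sphere)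
      then show ?thesis
        using that unfolding bounded_pos by blast
    qed
    define \<delta> where "\<delta> = 1 / max 1 M"
    have \<delta>: "\<delta> > 0" "\<delta> \<le> 1" by (auto simp: \<delta>_def)
    let ?u = "\<lambda>z. ln (max \<delta> (cmod (c z)))"
    \<comment> \<open>Where |c| < \<open>\<delta>\<close>, the term \<open>- ?u z\<close> equals
      \<open>ln (max 1 M)\<close> and alone pays for \<open>a\<close>. Elsewhere a = b / c, and
      log_plus (1 / x) = log_plus x - ln x for x > 0.\<close>
    have pt: "log_plus (cmod (a z)) \<le> log_plus (cmod (b z)) + log_plus (cmod (c z)) - ?u z"
      if z: "z \<in> sphere 0 r" for z
    proof (cases "cmod (c z) < \<delta>")
      case True
      then have "?u z = - ln (max 1 M)"
        by (simp add: \<delta>_def ln_div)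
      moreover have "log_plus (cmod (a z)) \<le> ln (max 1 M)"
        using M(2)[OF z] by (auto simp: log_plus_def)
      ultimately show ?thesis
        using log_plus_nonneg[of "cmod (b z)"] log_plus_nonneg[of "cmod (c z)"] by linarith
    next
      case False
      with \<delta> have nz: "cmod (c z) > 0" by linarith
      then have "a z = b z * inverse (c z)"
        using eq[of z] by (simp add: field_simps)
      then have "log_plus (cmod (a z)) \<le> log_plus (cmod (b z)) + log_plus (inverse (cmod (c z)))"
        using log_plus_mult_le[of "cmod (b z)" "inverse (cmod (c z))"] by (simp add: norm_mult norm_inverse)
      also have "log_plus (inverse (cmod (c z))) = log_plus (cmod (c z)) - ln (cmod (c z))"
        using nz one_le_inverse_iff[of "cmod (c z)"]
        by (cases "cmod (c z) \<le> 1") (auto simp: log_plus_def max_def ln_inverse)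
      also have "ln (cmod (c z)) = ?u z"
        using False by (simp add: max_def)
      finally show ?thesis by simp
    qed
    have "circle_avg (\<lambda>z. log_plus (cmod (a z))) r
        \<le> circle_avg (\<lambda>z. log_plus (cmod (b z)) + log_plus (cmod (c z)) - ?u z) r"
      using pt that \<delta> by (intro circle_avg_mono continuous_intros cont) auto
    also have "\<dots> = circle_avg (\<lambda>z. log_plus (cmod (b z)) + log_plus (cmod (c z))) r - circle_avg ?u r"
      using that \<delta> by (intro circle_avg_diff continuous_intros cont) auto
    also have "circle_avg (\<lambda>z. log_plus (cmod (b z)) + log_plus (cmod (c z))) r
        = circle_avg (\<lambda>z. log_plus (cmod (b z))) r + circle_avg (\<lambda>z. log_plus (cmod (c z))) r"
      using that by (intro circle_avg_add continuous_intros cont) auto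
    finally show ?thesis
      using C[OF that \<delta>(1)] by (simp add: nevanlinna_T_entire a b c)
  qed
  then show ?thesis
    using that by blast
qed

subsection \<open>Property (A) in terms of the characteristic\<close>

lemma max_modulus_attained:
  assumes "g holomorphic_on UNIV" "r \<ge> 0"
  obtains z where "z \<in> sphere 0 r" "max_modulus g r = cmod (g z)"
    "\<And>w. w \<in> sphere 0 r \<Longrightarrow> cmod (g w) \<le> cmod (g z)"
proof -
  have "continuous_on (sphere 0 r) (\<lambda>z. cmod (g z))"
    using assms(1) by (intro continuous_intros) (meson continuous_on_subset holomorphic_on_imp_continuous_on subset_UNIV)
  moreover have "of_real r \<in> sphere (0::complex) r"
    using assms(2) by simp
  then have "sphere (0::complex) r \<noteq> {}" by blast
  ultimately obtain z where z: "z \<in> sphere 0 r" "\<And>w. w \<in> sphere 0 r \<Longrightarrow> cmod (g w) \<le> cmod (g z)"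
    using continuous_attains_sup[OF compact_sphere, of 0 r "\<lambda>z. cmod (g z)"] by metis
  then have "max_modulus g r = cmod (g z)"
    unfolding max_modulus_def by (intro cSup_eq_maximum) blast+
  with z show ?thesis
    using that by blast
qed

lemma nevanlinna_T_le_log_max_modulus:
  assumes g: "g holomorphic_on UNIV" and "r \<ge> 0"
  shows "nevanlinna_T g r \<le> log_plus (max_modulus g r)"
proof -
  obtain z where z: "max_modulus g r = cmod (g z)"
    "\<And>w. w \<in> sphere 0 r \<Longrightarrow> cmod (g w) \<le> cmod (g z)"
    using max_modulus_attained[OF assms] by blast
  have "circle_avg (\<lambda>w. log_plus (cmod (g w))) r \<le> circle_avg (\<lambda>_. log_plus (cmod (g z))) r"
    using assms z by (intro circle_avg_mono continuous_intros holomorphic_on_imp_continuous_on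
        holomorphic_on_subset[OF g]) (auto intro: log_plus_mono)
  then show ?thesis
    using z by (simp add: nevanlinna_T_entire[OF g] circle_avg_const)
qed

lemma log_max_modulus_le_nevanlinna_T:
  assumes "g holomorphic_on UNIV" "r > 0"
  shows "log_plus (max_modulus g r) \<le> 3 * nevanlinna_T g (2 * r)"
proof -
  obtain z where "z \<in> sphere 0 r" "max_modulus g r = cmod (g z)"
    using max_modulus_attained[of g r] assms by (metis less_imp_le)
  then show ?thesis
    using log_plus_le_nevanlinna_T[OF assms, of z] by simp
qed

lemma filterlim_powr_at_top:
  assumes "\<sigma> > 0"
  shows "filterlim (\<lambda>r::real. r powr \<sigma>) at_top at_top"
  using assms by real_asymp

text \<open>Squaring the maximum modulus doubles its \<open>log_plus\<close> once it exceeds 1. In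
  the induction the bound for exponent \<open>sqrt \<sigma>\<close> is used twice: the exponents
  multiply to \<open>\<sigma>\<close> and the gain is squared.\<close>

lemma property_A_iterated:
  assumes "property_A g" "\<sigma> > 1"
  shows "\<forall>\<^sub>F r in at_top. 2 ^ Suc n * log_plus (max_modulus g r) \<le> log_plus (max_modulus g (r powr \<sigma>))"
  using assms(2)
proof (induction n arbitrary: \<sigma>)
  case 0
  then have "\<forall>\<^sub>F r in at_top. (max_modulus g r)\<^sup>2 \<le> max_modulus g (r powr \<sigma>)"
    using assms(1) by (simp add: property_A_def)
  then show ?case
  proof eventually_elim
    case (elim r)
    show ?case
    proof (cases "max_modulus g r \<le> 1")
      case True
      then show ?thesis
        using log_plus_nonneg by (simp add: log_plus_def)
    next
      case False
      then have "2 * log_plus (max_modulus g r) = log_plus ((max_modulus g r)\<^sup>2)"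
        using one_le_power[of "max_modulus g r" 2] by (simp add: log_plus_def max_def ln_realpow)
      also have "\<dots> \<le> log_plus (max_modulus g (r powr \<sigma>))"
        using elim by (rule log_plus_mono)
      finally show ?thesis by simp
    qed
  qed
next
  case (Suc n)
  define \<tau> where "\<tau> = sqrt \<sigma>"
  have \<tau>: "\<tau> > 1" "\<tau> * \<tau> = \<sigma>"
    using Suc.prems by (auto simp: \<tau>_def)
  from Suc.IH[OF \<tau>(1)]
  have "\<forall>\<^sub>F r in at_top. 2 ^ Suc n * log_plus (max_modulus g (r powr \<tau>))
      \<le> log_plus (max_modulus g ((r powr \<tau>) powr \<tau>))"
    by (rule eventually_compose_filterlim) (use \<tau> in \<open>intro filterlim_powr_at_top, auto\<close>)
  moreover have "\<forall>\<^sub>F r in at_top. (max_modulus g r)\<^sup>2 \<le> max_modulus g (r powr \<tau>)"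
    using assms(1) \<tau> by (simp add: property_A_def)
  ultimately show ?case
    using Suc.IH[OF \<tau>(1)]
  proof eventually_elim
    case (elim r)
    have "2 ^ Suc (Suc n) * log_plus (max_modulus g r) \<le> 2 ^ Suc n * (2 ^ Suc n * log_plus (max_modulus g r))"
      using mult_right_mono[of "2 ^ Suc (Suc n)" "2 ^ Suc n * 2 ^ Suc n" "log_plus (max_modulus g r)"]
      by (simp add: log_plus_nonneg mult.assoc)
    also have "\<dots> \<le> 2 ^ Suc n * log_plus (max_modulus g (r powr \<tau>))"
      using elim(3) by (intro mult_left_mono) auto
    also have "\<dots> \<le> log_plus (max_modulus g (r powr \<sigma>))"
      using elim(1) \<tau> by (simp add: powr_powr)
    finally show ?case .
  qed
qed

text \<open>The characteristic and the logarithm of the maximum modulus are comparable up to a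
  factor 3 and a dilation by 2. A large \<open>n\<close> absorbs the factor, and the gap between
  \<open>\<tau>\<close> and \<open>\<sigma>\<close> absorbs the dilation.\<close>

lemma property_A_nevanlinna_T:
  assumes A: "property_A g" and "\<sigma> > 1"
  shows "\<forall>\<^sub>F r in at_top. K * nevanlinna_T g r \<le> nevanlinna_T g (r powr \<sigma>)"
proof -
  have g: "g holomorphic_on UNIV"
    using A by (simp add: property_A_def nonconst_entire_def)
  obtain n where n: "3 * K < 2 ^ n"
    using real_arch_pow[of 2 "3 * K"] by auto
  define \<tau> where "\<tau> = (1 + \<sigma>) / 2"
  have \<tau>: "\<tau> > 1" "\<tau> < \<sigma>"
    using \<open>\<sigma> > 1\<close> by (auto simp: \<tau>_def)
  have "\<forall>\<^sub>F r::real in at_top. 2 * r powr \<tau> \<le> r powr \<sigma>"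
    using \<tau> by real_asymp
  then show ?thesis
    using property_A_iterated[OF A \<tau>(1), of n] eventually_gt_at_top[of 0]
  proof eventually_elim
    case (elim r)
    have "3 * K \<le> 2 ^ Suc n"
      using n zero_less_power[of "2::real" n] unfolding power_Suc by linarith
    then have "3 * (K * nevanlinna_T g r) \<le> 2 ^ Suc n * nevanlinna_T g r"
      using nevanlinna_T_nonneg[OF g, of r] mult_right_mono[of "3 * K" "2 ^ Suc n" "nevanlinna_T g r"]
      by (simp add: mult.assoc)
    also have "\<dots> \<le> 2 ^ Suc n * log_plus (max_modulus g r)"
      using nevanlinna_T_le_log_max_modulus[OF g, of r] elim by (intro mult_left_mono) auto
    also have "\<dots> \<le> log_plus (max_modulus g (r powr \<tau>))"
      by (rule elim(2))
    also have "\<dots> \<le> 3 * nevanlinna_T g (2 * r powr \<tau>)"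
      using elim by (intro log_max_modulus_le_nevanlinna_T[OF g]) auto
    also have "\<dots> \<le> 3 * nevanlinna_T g (r powr \<sigma>)"
      using elim by (intro mult_left_mono nevanlinna_T_mono[OF g]) auto
    finally show ?case by simp
  qed
qed

text \<open>Gain on the left, with \<open>le\<close> read at \<open>r powr \<sigma>\<close>. The
  factor 3 matches the three summands on the right, as \<open>C\<close> is eventually below the
  characteristic of \<open>b\<close>.\<close>

lemma nevanlinna_T_less_max_of_property_A:
  assumes A: "property_A a" and b: "nonconst_entire b" and c: "nonconst_entire c" and "\<sigma> > 1"
    and le: "\<And>r. r \<ge> 1 \<Longrightarrow> nevanlinna_T a r \<le> nevanlinna_T b r + nevanlinna_T c r + C"
  shows "\<forall>\<^sub>F r in at_top. nevanlinna_T a r < max (nevanlinna_T b (r powr \<sigma>)) (nevanlinna_T c (r powr \<sigma>))"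
proof -
  have "filterlim (\<lambda>r. nevanlinna_T b (r powr \<sigma>)) at_top at_top"
    using \<open>\<sigma> > 1\<close> by (intro filterlim_compose[OF filterlim_nevanlinna_T[OF b]] filterlim_powr_at_top) auto
  then have "\<forall>\<^sub>F r in at_top. nevanlinna_T b (r powr \<sigma>) > C"
    by (rule filterlim_at_top_dense[THEN iffD1, rule_format])
  then show ?thesis
    using property_A_nevanlinna_T[OF A \<open>\<sigma> > 1\<close>, of 3] eventually_ge_at_top[of 1]
  proof eventually_elim
    case (elim r)
    have "1 \<le> r powr \<sigma>"
      using elim \<open>\<sigma> > 1\<close> by (intro ge_one_powr_ge_zero) auto
    from elim(1,2) le[OF this] show ?case
      by (auto simp: max_def)
  qed
qed

text \<open>Gain on the right, with \<open>le\<close> read at \<open>r\<close>: each of the three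
  summands is at most a third of the maximum at \<open>r powr \<sigma>\<close>.\<close>

lemma nevanlinna_T_less_max_of_properties_A:
  assumes b: "property_A b" and c: "property_A c" and "\<sigma> > 1"
    and le: "\<And>r. r \<ge> 1 \<Longrightarrow> nevanlinna_T a r \<le> nevanlinna_T b r + nevanlinna_T c r + C"
  shows "\<forall>\<^sub>F r in at_top. nevanlinna_T a r < max (nevanlinna_T b (r powr \<sigma>)) (nevanlinna_T c (r powr \<sigma>))"
proof -
  have "\<forall>\<^sub>F r in at_top. nevanlinna_T b r > C"
    using b by (intro filterlim_at_top_dense[THEN iffD1, rule_format] filterlim_nevanlinna_T)
      (simp add: property_A_def)
  then show ?thesis
    using property_A_nevanlinna_T[OF b \<open>\<sigma> > 1\<close>, of 3] property_A_nevanlinna_T[OF c \<open>\<sigma> > 1\<close>, of 3]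
      eventually_ge_at_top[of 1]
  proof eventually_elim
    case (elim r)
    from elim(1,2,3) le[OF elim(4)] show ?case
      by (auto simp: max_def)
  qed
qed

subsection \<open>Growth of the characteristic of a meromorphic function\<close>

lemma finite_poles_cball:
  assumes "f meromorphic_on UNIV"
  shows "finite {z \<in> cball 0 r. is_pole f z}"
proof -
  have "{z. is_pole f z} sparse_in UNIV"
    using meromorphic_on_imp_not_pole_cosparse[OF assms] by (simp add: eventually_cosparse)
  then have "{z. is_pole f z} sparse_in cball 0 r"
    by (rule sparse_in_subset) auto
  then have "finite (cball 0 r \<inter> {z. is_pole f z})"
    by (rule sparse_in_compact_finite) auto
  then show ?thesis
    by (simp add: Int_def)
qed

text \<open>Integrating the counting function writes N as a sum of nonnegative contributions of the
  poles, from which only that of \<open>a\<close> is kept. A single pole thus forces at least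
  logarithmic growth.\<close>

lemma pole_counting_N_lower_bound:
  assumes f: "f meromorphic_on UNIV" and a: "is_pole f a" and r: "r \<ge> 1" "r \<ge> cmod a"
  shows "ln r - ln (cmod a) \<le> pole_counting_N f r"
proof -
  define S where "S = {z \<in> cball 0 r. is_pole f z}"
  define m where "m z = real (nat (- zorder f z))" for z
  have fin: "finite S"
    unfolding S_def by (rule finite_poles_cball[OF f])
  have "isolated_singularity_at f a"
    using f by (rule meromorphic_on_isolated_singularity[OF meromorphic_on_subset]) auto
  then have ma: "m a \<ge> 1"
    using isolated_pole_imp_neg_zorder[OF _ a] by (simp add: m_def)
  have count: "real (pole_count f t) = (\<Sum>z\<in>S. if cmod z \<le> t then m z else 0)" if "t \<le> r" for t
  proof -
    have "{z. z \<in> cball 0 t \<and> is_pole f z} = S \<inter> {z. cmod z \<le> t}"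
      using that by (auto simp: S_def)
    then show ?thesis
      using fin by (simp add: pole_count_def m_def sum.If_cases)
  qed
  have count0: "real (pole_count f 0) = (\<Sum>z\<in>S. if z = 0 then m z else 0)"
    using count[of 0] r by simp
  have "((\<lambda>t. if t \<in> {cmod z..r} then 1 / t else 0) has_integral (ln r - ln (cmod z))) {0..r}"
    if "z \<in> S - {0}" for z
  proof -
    have z: "cmod z > 0" "cmod z \<le> r" using that by (auto simp: S_def)
    have "((\<lambda>t. 1 / t) has_integral (ln r - ln (cmod z))) {cmod z..r}"
    proof (intro fundamental_theorem_of_calculus)
      show "(ln has_vector_derivative 1 / t) (at t within {cmod z..r})" if "t \<in> {cmod z..r}" for t
      proof -
        have "t > 0" using that z(1) unfolding atLeastAtMost_iff by linarith
        then show ?thesis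
          by (auto simp flip: has_real_derivative_iff_has_vector_derivative intro!: derivative_eq_intros)
      qed
    qed (use z in auto)
    then show ?thesis
      using z by (subst has_integral_restrict) auto
  qed
  then have "((\<lambda>t. \<Sum>z\<in>S - {0}. m z * (if t \<in> {cmod z..r} then 1 / t else 0)) has_integral
      (\<Sum>z\<in>S - {0}. m z * (ln r - ln (cmod z)))) {0..r}"
    using fin by (intro has_integral_sum has_integral_mult_right) auto
  moreover have "(real (pole_count f t) - real (pole_count f 0)) / t
      = (\<Sum>z\<in>S - {0}. m z * (if t \<in> {cmod z..r} then 1 / t else 0))" if "t \<in> {0..r}" for t
  proof -
    have "real (pole_count f t) - real (pole_count f 0)
        = (\<Sum>z\<in>S. (if cmod z \<le> t then m z else 0) - (if z = 0 then m z else 0))"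
      using that by (simp add: count count0 sum_subtractf)
    \<comment> \<open>Subtracting the count at 0 removes exactly the pole at the origin, so the
      division by \<open>t\<close> is harmless near 0.\<close>
    also have "\<dots> = (\<Sum>z\<in>S - {0}. if cmod z \<le> t then m z else 0)"
      using fin that by (intro sum.mono_neutral_cong_right) auto
    finally show ?thesis
      using that by (auto simp: sum_divide_distrib intro!: sum.cong split: if_splits)
  qed
  ultimately have "integral {0..r} (\<lambda>t. (real (pole_count f t) - real (pole_count f 0)) / t)
      = (\<Sum>z\<in>S - {0}. m z * (ln r - ln (cmod z)))"
    by (metis (no_types, lifting) has_integral_cong integral_unique)
  then have N: "pole_counting_N f r
      = (\<Sum>z\<in>S - {0}. m z * (ln r - ln (cmod z))) + (\<Sum>z\<in>S. if z = 0 then m z else 0) * ln r"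
    by (simp add: pole_counting_N_def count0)
  have term_nonneg: "m z * (ln r - ln (cmod z)) \<ge> 0" if "z \<in> S - {0}" for z
    using that r by (intro mult_nonneg_nonneg) (auto simp: S_def m_def)
  have zero_nonneg: "(\<Sum>z\<in>S. if z = 0 then m z else 0) \<ge> 0"
    by (intro sum_nonneg) (auto simp: m_def)
  have "a \<in> S" using a r by (simp add: S_def)
  show ?thesis
  proof (cases "a = 0")
    case True
    \<comment> \<open>For a pole at the origin, \<open>ln (cmod a)\<close> is the default value
      \<open>ln 0 = 0\<close>, so the term \<open>ln r\<close> alone has to be matched.\<close>
    have "(\<Sum>z\<in>S. if z = 0 then m z else 0) = m 0"
      using fin \<open>a \<in> S\<close> True by simp
    moreover have "1 * ln r \<le> m 0 * ln r"
      using ma True r by (intro mult_right_mono) auto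
    ultimately show ?thesis
      using True sum_nonneg[of "S - {0}" "\<lambda>z. m z * (ln r - ln (cmod z))"] term_nonneg
      unfolding N by simp
  next
    case False
    have "1 * (ln r - ln (cmod a)) \<le> m a * (ln r - ln (cmod a))"
      using ma False r by (intro mult_right_mono) auto
    also have "\<dots> \<le> (\<Sum>z\<in>S - {0}. m z * (ln r - ln (cmod z)))"
      using fin \<open>a \<in> S\<close> False term_nonneg by (intro member_le_sum) auto
    finally show ?thesis
      using zero_nonneg r unfolding N by (simp add: add_increasing2)
  qed
qed

lemma nevanlinna_T_cong_cosparse:
  assumes eq: "\<forall>\<^sub>\<approx>z\<in>UNIV. f z = F z" and np: "\<And>z. \<not> is_pole f z" and F: "F holomorphic_on UNIV"
    and "r > 0"
  shows "nevanlinna_T f r = nevanlinna_T F r"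
proof -
  define B where "B = {z \<in> cball 0 r. f z \<noteq> F z}"
  have "{z. f z \<noteq> F z} sparse_in UNIV"
    using eq by (simp add: eventually_cosparse)
  then have "{z. f z \<noteq> F z} sparse_in cball 0 r"
    by (rule sparse_in_subset) auto
  then have "finite (cball 0 r \<inter> {z. f z \<noteq> F z})"
    by (rule sparse_in_compact_finite) auto
  then have "finite B"
    by (simp add: B_def Int_def)
  have "inj_on (\<lambda>\<theta>. of_real r * cis \<theta>) {0..<2 * pi}"
  proof (rule inj_onI)
    fix x y assume xy: "x \<in> {0..<2 * pi}" "y \<in> {0..<2 * pi}" "of_real r * cis x = of_real r * cis y"
    have "cis x = cis y"
      using xy(3) \<open>r > 0\<close> by (subst (asm) mult_cancel_left) simp
    then have e: "exp (\<i> * of_real x) = exp (\<i> * of_real y)"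
      by (simp only: cis_conv_exp)
    have d: "\<bar>x - y\<bar> < 2 * pi"
    proof -
      have "0 \<le> x" "x < 2 * pi" "0 \<le> y" "y < 2 * pi"
        using xy(1,2) by simp_all
      then show ?thesis by (simp add: abs_less_iff)
    qed
    have "\<i> * of_real x = \<i> * of_real y"
      by (rule exp_complex_eqI[OF _ e]) (simp add: d)
    then show "x = y" by simp
  qed
  then have "finite ((\<lambda>\<theta>. of_real r * cis \<theta>) -` B \<inter> {0..<2 * pi})"
    using \<open>finite B\<close> by (rule finite_vimage_IntI[rotated])
  \<comment> \<open>The parametrisation is injective only on the half-open interval, so the endpoint
    \<open>2 * pi\<close> is added by hand.\<close>
  then have neg: "negligible (insert (2 * pi) ((\<lambda>\<theta>. of_real r * cis \<theta>) -` B \<inter> {0..<2 * pi}))"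
    by (intro negligible_finite) auto
  have "integral {0..2 * pi} (\<lambda>\<theta>. log_plus (cmod (f (of_real r * cis \<theta>))))
      = integral {0..2 * pi} (\<lambda>\<theta>. log_plus (cmod (F (of_real r * cis \<theta>))))"
    by (rule integral_spike[OF neg]) (use \<open>r > 0\<close> in \<open>auto simp: B_def norm_mult\<close>)
  then have "nevanlinna_T f r = circle_avg (\<lambda>z. log_plus (cmod (F z))) r"
    by (simp add: nevanlinna_T_def proximity_m_def pole_counting_N_def pole_count_def np circle_avg_def)
  then show ?thesis
    by (simp add: nevanlinna_T_entire[OF F])
qed

text \<open>A pole gives growth through the counting function; without poles, \<open>f\<close> is
  entire up to removable singularities. The constant case is later excluded by the non-vanishing of
  the lower orders.\<close>

lemma nevanlinna_T_at_top_or_const: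
  assumes f: "f meromorphic_on UNIV"
  shows "filterlim (nevanlinna_T f) at_top at_top \<or> (\<exists>c. \<forall>r>0. nevanlinna_T f r = c)"
proof (cases "\<exists>a. is_pole f a")
  case True
  then obtain a where a: "is_pole f a" by blast
  have "\<forall>\<^sub>F r in at_top. ln r - ln (cmod a) \<le> nevanlinna_T f r"
    using eventually_ge_at_top[of "max 1 (cmod a)"]
  proof eventually_elim
    case (elim r)
    have "proximity_m f r = circle_avg (\<lambda>z. log_plus (cmod (f z))) r"
      by (simp add: proximity_m_def circle_avg_def)
    then have "proximity_m f r \<ge> 0"
      by (simp add: circle_avg_nonneg log_plus_nonneg)
    with pole_counting_N_lower_bound[OF f a, of r] elim show ?case
      by (simp add: nevanlinna_T_def)
  qed
  moreover have "filterlim (\<lambda>r. ln r - ln (cmod a)) at_top at_top"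
    by real_asymp
  ultimately show ?thesis
    using filterlim_at_top_mono by blast
next
  case False
  define F where "F = remove_sings f"
  have "F analytic_on {z}" for z
  proof -
    have "f meromorphic_on {z}"
      using f by (rule meromorphic_on_subset) auto
    then have "isolated_singularity_at f z" "not_essential f z"
      by (auto simp: meromorphic_at_iff)
    then show ?thesis
      using False remove_sings_analytic_at unfolding F_def not_essential_def by blast
  qed
  then have F: "F holomorphic_on UNIV"
    by (meson analytic_imp_holomorphic analytic_on_analytic_at)
  have eq: "nevanlinna_T f r = nevanlinna_T F r" if "r > 0" for r
    using eventually_remove_sings_eq[OF f] False F that
    by (intro nevanlinna_T_cong_cosparse) (auto simp: F_def eq_commute)
  show ?thesis
  proof (cases "F constant_on UNIV")
    case True
    then obtain c where "F = (\<lambda>_. c)"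
      by (auto simp: constant_on_def)
    then have "nevanlinna_T F r = log_plus (cmod c)" for r
      using nevanlinna_T_entire[OF F] by (simp add: circle_avg_const)
    with eq show ?thesis by auto
  next
    case False
    then have "filterlim (nevanlinna_T F) at_top at_top"
      using F by (intro filterlim_nevanlinna_T) (simp add: nonconst_entire_def)
    moreover have "\<forall>\<^sub>F r in at_top. nevanlinna_T F r = nevanlinna_T f r"
      using eventually_gt_at_top[of 0] by eventually_elim (simp add: eq)
    ultimately show ?thesis
      using filterlim_cong[OF refl refl] by blast
  qed
qed

subsection \<open>Iterated logarithms and inverse characteristics\<close>

lemma iter_log_0: "iter_log 0 x = x"
  by (simp add: iter_log_def)

lemma iter_log_Suc: "iter_log (Suc k) x = ln (iter_log k x)"
  by (simp add: iter_log_def)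

lemma iter_log_Suc': "iter_log (Suc k) x = iter_log k (ln x)"
  by (simp add: iter_log_def funpow_swap1)

lemma filterlim_iter_log: "filterlim (iter_log k) at_top at_top"
proof (induction k)
  case 0
  then show ?case by (simp add: iter_log_0 filterlim_ident)
next
  case (Suc k)
  show ?case
    unfolding iter_log_Suc by (rule filterlim_compose[OF ln_at_top Suc.IH])
qed

text \<open>The threshold keeps the inner iterates positive, away from the conventional values of
  \<open>ln\<close>.\<close>

lemma iter_log_eventually_mono:
  obtains X where "\<And>x y. X \<le> x \<Longrightarrow> x \<le> y \<Longrightarrow> iter_log k x \<le> iter_log k y"
proof -
  have "\<exists>X. \<forall>x\<ge>X. \<forall>y\<ge>x. iter_log k x \<le> iter_log k y"
  proof (induction k)
    case 0
    then show ?case by (simp add: iter_log_0)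
  next
    case (Suc k)
    then obtain X where X: "\<And>x y. X \<le> x \<Longrightarrow> x \<le> y \<Longrightarrow> iter_log k x \<le> iter_log k y" by blast
    have "\<forall>\<^sub>F x in at_top. iter_log k x > 0"
      by (rule filterlim_at_top_dense[THEN iffD1, OF filterlim_iter_log, rule_format])
    then obtain Y where Y: "\<And>x. x \<ge> Y \<Longrightarrow> iter_log k x > 0"
      by (auto simp: eventually_at_top_linorder)
    have "iter_log (Suc k) x \<le> iter_log (Suc k) y" if "max X Y \<le> x" "x \<le> y" for x y
      using X[of x y] Y[of x] Y[of y] that by (simp add: iter_log_Suc)
    then show ?case by blast
  qed
  then show ?thesis
    using that by blast
qed

text \<open>A further logarithm turns the factor into the summand \<open>ln \<sigma>\<close>, which
  is at most \<open>\<sigma> - 1\<close> times the iterated logarithm once that exceeds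
  \<open>ln \<sigma> / (\<sigma> - 1)\<close>.\<close>

lemma iter_log_mult_le:
  assumes "\<sigma> > 1"
  shows "\<forall>\<^sub>F x in at_top. iter_log k (\<sigma> * x) \<le> \<sigma> * iter_log k x"
proof (induction k)
  case 0
  then show ?case by (simp add: iter_log_0)
next
  case (Suc k)
  have "filterlim (\<lambda>x. \<sigma> * x) at_top at_top"
    using assms by real_asymp
  then have "\<forall>\<^sub>F x in at_top. iter_log k (\<sigma> * x) > 0"
    by (intro filterlim_at_top_dense[THEN iffD1, rule_format] filterlim_compose[OF filterlim_iter_log])
  moreover have "\<forall>\<^sub>F x in at_top. iter_log k x > 0"
    by (rule filterlim_at_top_dense[THEN iffD1, OF filterlim_iter_log, rule_format])
  moreover have "\<forall>\<^sub>F x in at_top. iter_log (Suc k) x > ln \<sigma> / (\<sigma> - 1)"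
    by (rule filterlim_at_top_dense[THEN iffD1, OF filterlim_iter_log, rule_format])
  ultimately show ?case
    using Suc.IH
  proof eventually_elim
    case (elim x)
    have "iter_log (Suc k) (\<sigma> * x) \<le> ln (\<sigma> * iter_log k x)"
      using elim assms by (simp add: iter_log_Suc)
    also have "\<dots> = ln \<sigma> + iter_log (Suc k) x"
      using elim assms by (simp add: iter_log_Suc ln_mult_pos)
    also have "ln \<sigma> \<le> (\<sigma> - 1) * iter_log (Suc k) x"
      using elim(3) assms by (simp add: field_simps)
    finally show ?case
      by (simp add: algebra_simps)
  qed
qed

text \<open>The innermost logarithm, present because \<open>p \<ge> 1\<close>, turns the power into
  a factor; the other logarithms do not enlarge that factor.\<close>

lemma iter_log_powr_le:
  assumes "p \<ge> 1" "\<sigma> > 1"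
  shows "\<forall>\<^sub>F x in at_top. iter_log p (x powr \<sigma>) \<le> \<sigma> * iter_log p x"
proof -
  obtain k where p: "p = Suc k"
    using assms(1) by (cases p) auto
  have "\<forall>\<^sub>F x::real in at_top. iter_log k (\<sigma> * ln x) \<le> \<sigma> * iter_log k (ln x)"
    by (rule eventually_compose_filterlim[OF iter_log_mult_le[OF assms(2)] ln_at_top])
  then show ?thesis
    using eventually_gt_at_top[of 0]
    by eventually_elim (simp add: p iter_log_Suc' ln_powr)
qed

text \<open>The intermediate value theorem supplies a positive preimage of every \<open>s\<close>
  from the value at 1 on, so \<open>inv_into\<close> returns a genuine one.\<close>

lemma nevanlinna_T_inv_eventually:
  assumes "nonconst_entire g"
  shows "\<forall>\<^sub>F s in at_top. nevanlinna_T_inv g s > 0 \<and> nevanlinna_T g (nevanlinna_T_inv g s) = s"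
  using eventually_ge_at_top[of "nevanlinna_T g 1"]
proof eventually_elim
  case (elim s)
  have g: "g holomorphic_on UNIV"
    using assms by (simp add: nonconst_entire_def)
  have "\<forall>\<^sub>F r in at_top. nevanlinna_T g r \<ge> s"
    using filterlim_nevanlinna_T[OF assms] by (simp add: filterlim_at_top)
  then have "\<forall>\<^sub>F r in at_top. nevanlinna_T g r \<ge> s \<and> r \<ge> 1"
    using eventually_ge_at_top by (rule eventually_conj)
  then obtain R where R: "nevanlinna_T g R \<ge> s" "R \<ge> 1"
    using eventually_happens'[OF trivial_limit_at_top_linorder] by blast
  then obtain x where "x \<ge> 1" "nevanlinna_T g x = s"
    using IVT'[of "nevanlinna_T g" 1 s R] elim continuous_on_nevanlinna_T[OF g] by blast
  then have "s \<in> nevanlinna_T g ` {0<..}" by force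
  then show ?case
    unfolding nevanlinna_T_inv_def
    using inv_into_into[of s "nevanlinna_T g" "{0<..}"] f_inv_into_f[of s "nevanlinna_T g" "{0<..}"] by simp
qed

lemma filterlim_nevanlinna_T_inv:
  assumes "nonconst_entire g"
  shows "filterlim (nevanlinna_T_inv g) at_top at_top"
  unfolding filterlim_at_top
proof
  fix X
  have g: "g holomorphic_on UNIV"
    using assms by (simp add: nonconst_entire_def)
  show "\<forall>\<^sub>F s in at_top. X \<le> nevanlinna_T_inv g s"
    using nevanlinna_T_inv_eventually[OF assms] eventually_gt_at_top[of "nevanlinna_T g X"]
  proof eventually_elim
    case (elim s)
    then show ?case
      using nevanlinna_T_mono[OF g, of "nevanlinna_T_inv g s" X] by linarith
  qed
qed

subsection \<open>Comparison of relative lower orders\<close>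

text \<open>Put r equal to the inverse of \<open>a\<close> at \<open>s\<close>. Then
  \<open>s\<close> lies below the characteristic of \<open>b\<close> or of \<open>c\<close> at
  \<open>r powr \<sigma>\<close>, and monotonicity bounds the corresponding inverse. Which one it is
  may vary with \<open>s\<close>, hence the minimum.\<close>

lemma iter_log_nevanlinna_T_inv_min_le:
  assumes a: "nonconst_entire a" and b: "nonconst_entire b" and c: "nonconst_entire c"
    and "p \<ge> 1" "\<sigma> > 1"
    and less: "\<forall>\<^sub>F r in at_top. nevanlinna_T a r < max (nevanlinna_T b (r powr \<sigma>)) (nevanlinna_T c (r powr \<sigma>))"
  shows "\<forall>\<^sub>F s in at_top. min (iter_log p (nevanlinna_T_inv b s)) (iter_log p (nevanlinna_T_inv c s))
    \<le> \<sigma> * iter_log p (nevanlinna_T_inv a s)"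
proof -
  obtain X where X: "\<And>x y. X \<le> x \<Longrightarrow> x \<le> y \<Longrightarrow> iter_log p x \<le> iter_log p y"
    using iter_log_eventually_mono by blast
  have ev: "\<forall>\<^sub>F s in at_top. P (nevanlinna_T_inv g s)"
    if "nonconst_entire g" "\<forall>\<^sub>F r in at_top. P r" for P g
    using that(2) filterlim_nevanlinna_T_inv[OF that(1)] by (rule eventually_compose_filterlim)
  have imp: "iter_log p (nevanlinna_T_inv g s) \<le> \<sigma> * iter_log p y"
    if g: "nonconst_entire g" and inv: "nevanlinna_T g (nevanlinna_T_inv g s) = s"
      and "X \<le> nevanlinna_T_inv g s" and y: "y > 0" "s < nevanlinna_T g (y powr \<sigma>)"
      and le: "iter_log p (y powr \<sigma>) \<le> \<sigma> * iter_log p y" for g s y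
  proof -
    have "nevanlinna_T_inv g s \<le> y powr \<sigma>"
    proof (rule ccontr)
      assume "\<not> ?thesis"
      then have "nevanlinna_T g (y powr \<sigma>) \<le> nevanlinna_T g (nevanlinna_T_inv g s)"
        using g y by (intro nevanlinna_T_mono) (auto simp: nonconst_entire_def)
      with inv y show False by simp
    qed
    with X[OF \<open>X \<le> nevanlinna_T_inv g s\<close>] le show ?thesis
      by (meson order_trans)
  qed
  show ?thesis
    using nevanlinna_T_inv_eventually[OF a] nevanlinna_T_inv_eventually[OF b] nevanlinna_T_inv_eventually[OF c]
      ev[OF b eventually_ge_at_top[of X]] ev[OF c eventually_ge_at_top[of X]]
      ev[OF a less] ev[OF a iter_log_powr_le[OF \<open>p \<ge> 1\<close> \<open>\<sigma> > 1\<close>]]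
  proof eventually_elim
    case (elim s)
    let ?y = "nevanlinna_T_inv a s"
    from elim(1,6) have "s < nevanlinna_T b (?y powr \<sigma>) \<or> s < nevanlinna_T c (?y powr \<sigma>)"
      by (simp add: less_max_iff_disj)
    then show ?case
    proof
      assume "s < nevanlinna_T b (?y powr \<sigma>)"
      with imp[OF b, of s ?y] elim show ?thesis by (simp add: min.coboundedI1)
    next
      assume "s < nevanlinna_T c (?y powr \<sigma>)"
      with imp[OF c, of s ?y] elim show ?thesis by (simp add: min.coboundedI2)
    qed
  qed
qed

text \<open>The passage \<open>\<sigma>\<close> to 1 without limits: each \<open>y\<close> below the
  minimum leaves room for one suitable \<open>\<sigma>\<close>. Negative \<open>y\<close> are
  settled by the positivity of the quotient.\<close>

lemma Liminf_ge_min_if_scaled: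
  fixes A B C D :: "real \<Rightarrow> real"
  assumes scaled: "\<And>\<sigma>. \<sigma> > 1 \<Longrightarrow> \<forall>\<^sub>F r in at_top. min (B r) (C r) \<le> \<sigma> * A r"
    and A: "\<forall>\<^sub>F r in at_top. A r > 0" and D: "\<forall>\<^sub>F r in at_top. D r > 0"
  shows "min (Liminf at_top (\<lambda>r. ereal (B r / D r))) (Liminf at_top (\<lambda>r. ereal (C r / D r)))
    \<le> Liminf at_top (\<lambda>r. ereal (A r / D r))" (is "?m \<le> _")
  unfolding le_Liminf_iff
proof (intro allI impI)
  fix y :: ereal assume y: "y < ?m"
  show "\<forall>\<^sub>F r in at_top. y < ereal (A r / D r)"
  proof (cases "y < 0")
    case True
    from A D show ?thesis
    proof eventually_elim
      case (elim r)
      then have "0 < ereal (A r / D r)" by simp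
      with True show ?case by (rule less_trans)
    qed
  next
    case False
    obtain y' where y': "y < y'" "y' < ?m"
      using dense[OF y] by blast
    with False obtain u v where uv: "y = ereal u" "y' = ereal v" "0 \<le> u" "u < v"
      by (cases y; cases y') auto
    \<comment> \<open>With this choice \<sigma> u = u + (v - u) u / (u + 1), which stays below v
      since u / (u + 1) < 1.\<close>
    define \<sigma> where "\<sigma> = 1 + (v - u) / (u + 1)"
    have \<sigma>: "\<sigma> > 1" "\<sigma> * u < v"
      using uv by (auto simp: \<sigma>_def field_simps)
    have "\<forall>\<^sub>F r in at_top. y' < ereal (B r / D r)" "\<forall>\<^sub>F r in at_top. y' < ereal (C r / D r)"
      using y'(2) by (auto intro: less_LiminfD)
    then show ?thesis
      using scaled[OF \<sigma>(1)] D
    proof eventually_elim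
      case (elim r)
      then have "v * D r < min (B r) (C r)"
        by (simp add: uv field_simps)
      also have "\<dots> \<le> \<sigma> * A r"
        by (rule elim(3))
      finally have "\<sigma> * u * D r < \<sigma> * A r"
        using mult_strict_right_mono[OF \<sigma>(2) elim(4)] by linarith
      then show ?case
        using elim(4) \<sigma>(1) by (simp add: uv field_simps)
    qed
  qed
qed

lemma rel_lower_order_ge_min:
  assumes a: "nonconst_entire a" and b: "nonconst_entire b" and c: "nonconst_entire c"
    and "p \<ge> 1"
    and \<phi>: "filterlim \<phi> at_top at_top" and f: "filterlim (nevanlinna_T f) at_top at_top"
    and less: "\<And>\<sigma>. \<sigma> > 1 \<Longrightarrow> \<forall>\<^sub>F r in at_top.
      nevanlinna_T a r < max (nevanlinna_T b (r powr \<sigma>)) (nevanlinna_T c (r powr \<sigma>))"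
  shows "min (rel_lower_order p q \<phi> b f) (rel_lower_order p q \<phi> c f) \<le> rel_lower_order p q \<phi> a f"
  unfolding rel_lower_order_def
proof (rule Liminf_ge_min_if_scaled)
  show "\<forall>\<^sub>F r in at_top. min (iter_log p (nevanlinna_T_inv b (nevanlinna_T f r)))
      (iter_log p (nevanlinna_T_inv c (nevanlinna_T f r)))
    \<le> \<sigma> * iter_log p (nevanlinna_T_inv a (nevanlinna_T f r))" if "\<sigma> > 1" for \<sigma>
    by (rule eventually_compose_filterlim[OF iter_log_nevanlinna_T_inv_min_le[OF a b c \<open>p \<ge> 1\<close> that less[OF that]] f])
  have "filterlim (\<lambda>r. iter_log p (nevanlinna_T_inv a (nevanlinna_T f r))) at_top at_top"
    by (intro filterlim_compose[OF filterlim_iter_log] filterlim_compose[OF filterlim_nevanlinna_T_inv[OF a]] f)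
  then show "\<forall>\<^sub>F r in at_top. 0 < iter_log p (nevanlinna_T_inv a (nevanlinna_T f r))"
    by (simp add: filterlim_at_top_dense)
  have "filterlim (\<lambda>r. iter_log q (\<phi> r)) at_top at_top"
    by (intro filterlim_compose[OF filterlim_iter_log] \<phi>)
  then show "\<forall>\<^sub>F r in at_top. 0 < iter_log q (\<phi> r)"
    by (simp add: filterlim_at_top_dense)
qed

lemma rel_lower_order_eq_0_if_nevanlinna_T_const:
  assumes "filterlim \<phi> at_top at_top" and "\<forall>r>0. nevanlinna_T f r = k"
  shows "rel_lower_order p q \<phi> g f = 0"
proof -
  have "filterlim (\<lambda>r. iter_log q (\<phi> r)) at_top at_top"
    by (intro filterlim_compose[OF filterlim_iter_log] assms(1))
  then have "((\<lambda>r. iter_log p (nevanlinna_T_inv g k) / iter_log q (\<phi> r)) \<longlongrightarrow> 0) at_top"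
    by (rule real_tendsto_divide_at_top[OF tendsto_const])
  then have "((\<lambda>r. iter_log p (nevanlinna_T_inv g (nevanlinna_T f r)) / iter_log q (\<phi> r)) \<longlongrightarrow> 0) at_top"
    by (rule Lim_transform_eventually)
      (use eventually_gt_at_top[of 0] in \<open>eventually_elim, use assms(2) in simp\<close>)
  then have "((\<lambda>r. ereal (iter_log p (nevanlinna_T_inv g (nevanlinna_T f r)) / iter_log q (\<phi> r)))
      \<longlongrightarrow> ereal 0) at_top"
    by (rule tendsto_ereal)
  then show ?thesis
    unfolding rel_lower_order_def zero_ereal_def by (rule lim_imp_Liminf[rotated]) simp
qed

lemma filterlim_at_top_if_mono_unbounded:
  fixes \<phi> :: "real \<Rightarrow> real"
  assumes pos: "\<And>r. r \<ge> 0 \<Longrightarrow> \<phi> r > 0" and mono: "mono_on {0..} \<phi>"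
    and unb: "\<not> bounded (\<phi> ` {0..})"
  shows "filterlim \<phi> at_top at_top"
  unfolding filterlim_at_top
proof
  fix K
  have "\<exists>x\<ge>0. \<phi> x > K"
  proof (rule ccontr)
    assume *: "\<not> ?thesis"
    have "norm y \<le> K" if y: "y \<in> \<phi> ` {0..}" for y
    proof -
      obtain x where "x \<ge> 0" "y = \<phi> x" using y by auto
      with pos[of x] that * show ?thesis by (metis abs_of_pos not_le real_norm_def)
    qed
    with unb show False
      unfolding bounded_iff by blast
  qed
  then obtain x where x: "x \<ge> 0" "\<phi> x > K" by blast
  show "\<forall>\<^sub>F r in at_top. K \<le> \<phi> r"
    using eventually_ge_at_top[of x]
  proof eventually_elim
    case (elim r)
    with x mono_onD[OF mono, of x r] show ?case by simp
  qed
qed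

lemma nonconst_entire_imp_nonzero: "nonconst_entire g \<Longrightarrow> \<exists>z. g z \<noteq> 0"
  by (auto simp: nonconst_entire_def constant_on_def)

theorem theorem10:
  fixes p q :: nat and \<phi> :: "real \<Rightarrow> real" and f1 g1 g2 :: "complex \<Rightarrow> complex"
  assumes "p \<ge> 1" and "q \<ge> 1"
    and "\<And>r. r \<ge> 0 \<Longrightarrow> \<phi> r > 0"
    and "mono_on {0..} \<phi>"
    and "\<not> bounded (\<phi> ` {0..})"
    and "f1 meromorphic_on UNIV"
    and "nonconst_entire g1" and "nonconst_entire g2"
    and "rel_lower_order p q \<phi> g1 f1 \<notin> {0, \<infinity>, -\<infinity>}"
    and "rel_lower_order p q \<phi> g2 f1 \<notin> {0, \<infinity>, -\<infinity>}"
  shows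
    "(property_A (\<lambda>z. g1 z * g2 z) \<and>
      rel_lower_order p q \<phi> (\<lambda>z. g1 z * g2 z) f1 \<notin> {0, \<infinity>, -\<infinity>} \<longrightarrow>
        rel_lower_order p q \<phi> (\<lambda>z. g1 z * g2 z) f1
          \<ge> min (rel_lower_order p q \<phi> g1 f1) (rel_lower_order p q \<phi> g2 f1) \<and>
        (rel_lower_order p q \<phi> g1 f1 < rel_lower_order p q \<phi> g2 f1 \<and> property_A g1 \<or>
         rel_lower_order p q \<phi> g2 f1 < rel_lower_order p q \<phi> g1 f1 \<and> property_A g2 \<longrightarrow>
           rel_lower_order p q \<phi> (\<lambda>z. g1 z * g2 z) f1
             = min (rel_lower_order p q \<phi> g1 f1) (rel_lower_order p q \<phi> g2 f1))) \<and>
     (\<forall>h. h holomorphic_on UNIV \<and> (\<forall>z. g2 z \<noteq> 0 \<longrightarrow> h z = g1 z / g2 z) \<and> property_A h \<and>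
      rel_lower_order p q \<phi> h f1 \<notin> {0, \<infinity>, -\<infinity>} \<longrightarrow>
        rel_lower_order p q \<phi> h f1
          \<ge> min (rel_lower_order p q \<phi> g1 f1) (rel_lower_order p q \<phi> g2 f1) \<and>
        (rel_lower_order p q \<phi> g1 f1 \<noteq> rel_lower_order p q \<phi> g2 f1 \<and> property_A g1 \<longrightarrow>
           rel_lower_order p q \<phi> h f1
             = min (rel_lower_order p q \<phi> g1 f1) (rel_lower_order p q \<phi> g2 f1)))"
proof -
  note g1 = \<open>nonconst_entire g1\<close> and g2 = \<open>nonconst_entire g2\<close>
  have h1: "g1 holomorphic_on UNIV" and h2: "g2 holomorphic_on UNIV"
    using g1 g2 by (auto simp: nonconst_entire_def)
  obtain w where w: "g2 w \<noteq> 0"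
    using nonconst_entire_imp_nonzero[OF g2] by blast
  have \<phi>: "filterlim \<phi> at_top at_top"
    by (rule filterlim_at_top_if_mono_unbounded) fact+
  \<comment> \<open>If the characteristic of \<open>f1\<close> were constant, its lower order
    relative to \<open>g1\<close> would be 0, contrary to hypothesis.\<close>
  have f: "filterlim (nevanlinna_T f1) at_top at_top"
    using nevanlinna_T_at_top_or_const[OF \<open>f1 meromorphic_on UNIV\<close>]
      rel_lower_order_eq_0_if_nevanlinna_T_const[OF \<phi>, of f1]
      \<open>rel_lower_order p q \<phi> g1 f1 \<notin> {0, \<infinity>, -\<infinity>}\<close> by blast
  define \<Lambda> where "\<Lambda> g = rel_lower_order p q \<phi> g f1" for g
  note ge_min = rel_lower_order_ge_min[OF _ _ _ \<open>p \<ge> 1\<close> \<phi> f, where q = q, folded \<Lambda>_def]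
  have A_nonconst: "nonconst_entire g" if "property_A g" for g
    using that by (simp add: property_A_def)
  have from_A: "min (\<Lambda> b) (\<Lambda> c) \<le> \<Lambda> a"
    if a: "property_A a" and bc: "nonconst_entire b" "nonconst_entire c"
      and le: "\<And>r. r \<ge> 1 \<Longrightarrow> nevanlinna_T a r \<le> nevanlinna_T b r + nevanlinna_T c r + C" for a b c C
    by (rule ge_min[OF A_nonconst[OF a] bc nevanlinna_T_less_max_of_property_A[OF a bc _ le]])
  have from_A_quotient: "min (\<Lambda> b) (\<Lambda> c) \<le> \<Lambda> a"
    if a: "property_A a" and b: "nonconst_entire b" and c: "nonconst_entire c"
      and eq: "\<And>z. c z \<noteq> 0 \<Longrightarrow> a z * c z = b z" for a b c
  proof -
    obtain u where "c u \<noteq> 0"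
      using nonconst_entire_imp_nonzero[OF c] by blast
    then obtain C where "\<And>r. r \<ge> 1 \<Longrightarrow> nevanlinna_T a r \<le> nevanlinna_T b r + nevanlinna_T c r + C"
      using nevanlinna_T_quotient_le[of a b c u] eq A_nonconst[OF a] b c
      unfolding nonconst_entire_def by metis
    then show ?thesis
      by (rule from_A[OF a b c])
  qed
  have product: "min (\<Lambda> g1) (\<Lambda> g2) \<le> \<Lambda> h \<and>
      (\<Lambda> g1 < \<Lambda> g2 \<and> property_A g1 \<or> \<Lambda> g2 < \<Lambda> g1 \<and> property_A g2 \<longrightarrow> \<Lambda> h = min (\<Lambda> g1) (\<Lambda> g2))"
    if h: "property_A h" and h_def: "h = (\<lambda>z. g1 z * g2 z)" for h
  proof -
    have ge: "min (\<Lambda> g1) (\<Lambda> g2) \<le> \<Lambda> h"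
      using nevanlinna_T_mult_le[OF h1 h2] by (intro from_A[OF h g1 g2, where C = 0]) (simp add: h_def)
    \<comment> \<open>Here \<open>g1\<close> is the quotient of \<open>h\<close> by
      \<open>g2\<close>. If \<open>\<Lambda> g1 < \<Lambda> g2\<close>, the minimum must be
      \<open>\<Lambda> h\<close>, which gives the reverse inequality.\<close>
    have "min (\<Lambda> h) (\<Lambda> g2) \<le> \<Lambda> g1" if "property_A g1"
      by (rule from_A_quotient[OF that A_nonconst[OF h] g2]) (simp add: h_def)
    moreover have "min (\<Lambda> h) (\<Lambda> g1) \<le> \<Lambda> g2" if "property_A g2"
      by (rule from_A_quotient[OF that A_nonconst[OF h] g1]) (simp add: h_def)
    ultimately show ?thesis
      using ge by (auto simp: min_def split: if_splits)
  qed
  have quotient: "min (\<Lambda> g1) (\<Lambda> g2) \<le> \<Lambda> h \<and>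
      (\<Lambda> g1 \<noteq> \<Lambda> g2 \<and> property_A g1 \<longrightarrow> \<Lambda> h = min (\<Lambda> g1) (\<Lambda> g2))"
    if hol: "h holomorphic_on UNIV" and h: "property_A h"
      and quot: "\<forall>z. g2 z \<noteq> 0 \<longrightarrow> h z = g1 z / g2 z" for h
  proof -
    \<comment> \<open>At zeros of \<open>g2\<close> the quotient formula says nothing about
      \<open>h\<close>; the identity theorem extends the product relation from the open set where
      \<open>g2\<close> does not vanish.\<close>
    have eq: "h z * g2 z = g1 z" for z
    proof (rule analytic_continuation_open[of "{z. g2 z \<noteq> 0}" UNIV "\<lambda>z. h z * g2 z" g1])
      show "open {z. g2 z \<noteq> 0}"
        using h2 by (intro open_Collect_neq holomorphic_on_imp_continuous_on continuous_on_const)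
      show "(\<lambda>z. h z * g2 z) holomorphic_on UNIV"
        by (intro holomorphic_intros hol h2)
    qed (use w quot h1 in auto)
    have ge: "min (\<Lambda> g1) (\<Lambda> g2) \<le> \<Lambda> h"
      by (rule from_A_quotient[OF h g1 g2]) (rule eq)
    have le1: "min (\<Lambda> h) (\<Lambda> g2) \<le> \<Lambda> g1" if "property_A g1"
      using nevanlinna_T_mult_le[OF hol h2]
      by (intro from_A[OF that A_nonconst[OF h] g2, where C = 0]) (simp add: eq)
    \<comment> \<open>Now \<open>g2\<close> is the quotient of \<open>g1\<close> by
      \<open>h\<close>, and Property (A) is available for \<open>g1\<close> and \<open>h\<close>. If
      \<open>\<Lambda> g2 < \<Lambda> g1\<close>, this forces
      \<open>\<Lambda> h \<le> \<Lambda> g2\<close>.\<close>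
    have le2: "min (\<Lambda> g1) (\<Lambda> h) \<le> \<Lambda> g2" if A: "property_A g1"
    proof -
      obtain u where "h u \<noteq> 0"
        using nonconst_entire_imp_nonzero[OF A_nonconst[OF h]] by blast
      moreover have "g2 z * h z = g1 z" for z
        using eq[of z] by (simp add: mult.commute)
      ultimately obtain C where
        "\<And>r. r \<ge> 1 \<Longrightarrow> nevanlinna_T g2 r \<le> nevanlinna_T g1 r + nevanlinna_T h r + C"
        using nevanlinna_T_quotient_le[OF h2 h1 hol] by metis
      then show ?thesis
        by (intro ge_min[OF g2 g1 A_nonconst[OF h]] nevanlinna_T_less_max_of_properties_A[OF A h])
    qed
    show ?thesis
      using ge le1 le2 by (auto simp: min_def split: if_splits)
  qed
  show ?thesis
    using product quotient unfolding \<Lambda>_def by blast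
qed

end
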